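(* Let $k$ be a field. Let $P(X,Z)\in k[X,Z]$ be monic in $Z$ with $\deg_Z P=r\ge 2$ and $Q(X,Y,Z)\in k[X,Y,Z]$ be monic in $Y$ with $\deg_Y Q=s\ge 2$. For positive integers $d,e$ let $$B_{d,e}=\frac{k[X,Y,Z,T]}{(X^{d}Y-P(X,Z),\;X^{e}T-Q(X,Y,Z))}.$$ Write $$P(X,Z)=a_0(X)+a_1(X)Z+\dots+a_{r-1}(X)Z^{r-1}+Z^{r},$$ $$Q(X,Y,Z)=b_0(X,Z)+b_1(X,Z)Y+\dots+b_{s-1}(X,Z)Y^{s-1}+Y^{s},$$ and define $$P'(X,Z)=a_1(X)+\dots+(r-1)a_{r-1}(X)Z^{r-2}+rZ^{r-1},$$ $$Q'(X,Y,Z)=b_1(X,Z)+2b_2(X,Z)Y+\dots+(s-1)b_{s-1}(X,Z)Y^{s-2}+sY^{s-1}.$$ Suppose that $$(P(0,Z),P'(0,Z))k[Z]=k[Z]\quad\text{and}\quad (P(0,Z),Q(0,Y,Z),Q'(0,Y,Z))k[Y,Z]=k[Y,Z].$$ Then, for $e\ge 2$ (and any positive integer $d$), $B_{d,e}^{[1]}\cong B_{d,e-1}^{[1]}$ as $k$-algebras.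
   Context: For a ring $C$, $C^{[1]}$ denotes the polynomial ring in one variable over $C$. For a ring $S$, $(a,b,\dots)S$ denotes the ideal of $S$ generated by $a,b,\dots$. *)

theory Defs
  imports
    "HOL-Algebra.QuotRing"
    "HOL-Algebra.UnivPoly"
    "HOL-Algebra.Algebraic_Closure_Type"
    "HOL-Computational_Algebra.Polynomial"
begin

text \<open>
  Polynomial rings over the field are iterated types of univariate polynomials, with the variables
  adjoined in the order X, Z, Y, T. Thus k[X,Z] is \<^typ>\<open>'k poly poly\<close> with outer variable Z,
  k[X,Z,Y] is \<^typ>\<open>'k poly poly poly\<close> with outer variable Y, and k[X,Z,Y,T] is
  \<^typ>\<open>'k poly poly poly poly\<close> with outer variable T. Being monic, the degree and the
  derivative (\<^const>\<open>pderiv\<close>) all refer to the outer variable, which is Z for P and Y for Q.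
\<close>

definition var_X :: "'k::field poly poly poly poly"
  where "var_X = [:[:[:[:0, 1:]:]:]:]"

definition var_Y :: "'k::field poly poly poly poly"
  where "var_Y = [:[:0, 1:]:]"

definition var_T :: "'k::field poly poly poly poly"
  where "var_T = [:0, 1:]"

definition XZ_to_XZYT :: "'k::field poly poly \<Rightarrow> 'k poly poly poly poly"
  where "XZ_to_XZYT P = [:[:P:]:]"

definition XZY_to_XZYT :: "'k::field poly poly poly \<Rightarrow> 'k poly poly poly poly"
  where "XZY_to_XZYT Q = [:Q:]"

definition P_at_X0 :: "'k::field poly poly \<Rightarrow> 'k poly"
  where "P_at_X0 P = map_poly (\<lambda>a. poly a 0) P"

definition Q_at_X0 :: "'k::field poly poly poly \<Rightarrow> 'k poly poly"
  where "Q_at_X0 Q = map_poly P_at_X0 Q"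

definition ideal_B ::
    "'k::field poly poly \<Rightarrow> 'k poly poly poly \<Rightarrow> nat \<Rightarrow> nat \<Rightarrow> 'k poly poly poly poly set"
  where "ideal_B P Q d e =
    Idl\<^bsub>ring_of_type_algebra\<^esub>
      {var_X ^ d * var_Y - XZ_to_XZYT P, var_X ^ e * var_T - XZY_to_XZYT Q}"

definition ring_B ::
    "'k::field poly poly \<Rightarrow> 'k poly poly poly \<Rightarrow> nat \<Rightarrow> nat \<Rightarrow> 'k poly poly poly poly set ring"
  where "ring_B P Q d e = ring_of_type_algebra Quot ideal_B P Q d e"

text \<open>
  A k-algebra is a ring together with its structure map from k; the following are the structure
  maps of B and of the polynomial ring \<open>UP B\<close> in one variable over B.
\<close>

definition scalar_B ::
    "'k::field poly poly \<Rightarrow> 'k poly poly poly \<Rightarrow> nat \<Rightarrow> nat \<Rightarrow> 'k \<Rightarrow> 'k poly poly poly poly set"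
  where "scalar_B P Q d e c = ideal_B P Q d e +>\<^bsub>ring_of_type_algebra\<^esub> [:[:[:[:c:]:]:]:]"

definition scalar_UP_B ::
    "'k::field poly poly \<Rightarrow> 'k poly poly poly \<Rightarrow> nat \<Rightarrow> nat \<Rightarrow> 'k
      \<Rightarrow> nat \<Rightarrow> 'k poly poly poly poly set"
  where "scalar_UP_B P Q d e c =
    up_ring.monom (UP (ring_B P Q d e)) (scalar_B P Q d e c) 0"

definition algebra_isomorphic ::
    "('a, 'm) ring_scheme \<Rightarrow> ('k \<Rightarrow> 'a) \<Rightarrow> ('b, 'n) ring_scheme \<Rightarrow> ('k \<Rightarrow> 'b) \<Rightarrow> bool"
  where "algebra_isomorphic A \<sigma> B \<tau> \<longleftrightarrow> (\<exists>h \<in> ring_iso A B. \<forall>c. h (\<sigma> c) = \<tau> c)"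

end

theory Submission
  imports Defs
begin

text \<open>
  Work in \<open>L = k(x,z\<^sub>2)[w]\<close>. Put \<open>z\<^sub>1 = z\<^sub>2 - x\<^bsup>d+e-1\<^esup> w\<close>, \<open>y\<^sub>i = P(x,z\<^sub>i) / x\<^bsup>d\<^esup>\<close>,
  \<open>t\<^sub>1 = Q(x,y\<^sub>1,z\<^sub>1) / x\<^bsup>e\<^esup>\<close> and \<open>t\<^sub>2 = Q(x,y\<^sub>2,z\<^sub>2) / x\<^bsup>e-1\<^esup>\<close>, so that \<open>k[x,z\<^sub>1,y\<^sub>1,t\<^sub>1]\<close>
  is a copy of \<open>B\<^bsub>d,e\<^esub>\<close> and \<open>k[x,z\<^sub>2,y\<^sub>2,t\<^sub>2]\<close> one of \<open>B\<^bsub>d,e-1\<^esub>\<close>. Taylor expansion shows that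
  \<open>x t\<^sub>1\<close> is congruent to \<open>t\<^sub>2 - w P' Q'\<close> modulo \<open>x\<close>. By the two coprimality hypotheses some \<open>\<alpha>\<close> in
  \<open>k[y\<^sub>2,z\<^sub>2]\<close> inverts \<open>P' Q'\<close> modulo \<open>x\<close>, so \<open>w' = (\<alpha> t\<^sub>2 - w) / x\<close> satisfies
  \<open>k[x,z\<^sub>1,y\<^sub>1,t\<^sub>1,w] = k[x,z\<^sub>2,y\<^sub>2,t\<^sub>2,w']\<close>: one subring of \<open>L\<close> is a polynomial ring in one variable
  over both algebras. That the presentations have no further relations follows since \<open>X\<close> is a nonzerodivisor
  modulo the defining ideal and \<open>(x,z\<^sub>1,w)\<close>, \<open>(x,z\<^sub>2,w')\<close> are algebraically independent.
\<close>

section \<open>Ring homomorphisms between types and evaluation\<close>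

text \<open>Homomorphisms between rings that are whole types, so that the calculations can use
  type-class simplification; carriers enter only with the quotient rings.\<close>

definition is_hom :: "('a::comm_ring_1 \<Rightarrow> 'b::comm_ring_1) \<Rightarrow> bool" where
  "is_hom h \<longleftrightarrow> h 1 = 1 \<and> (\<forall>a b. h (a + b) = h a + h b) \<and> (\<forall>a b. h (a * b) = h a * h b)"

lemma is_homI:
  assumes "h 1 = 1" "\<And>a b. h (a + b) = h a + h b" "\<And>a b. h (a * b) = h a * h b"
  shows "is_hom h"
  using assms by (simp add: is_hom_def)

lemma is_hom_one: "is_hom h \<Longrightarrow> h 1 = 1"
  and is_hom_add: "is_hom h \<Longrightarrow> h (a + b) = h a + h b"
  and is_hom_mult: "is_hom h \<Longrightarrow> h (a * b) = h a * h b"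
  by (auto simp: is_hom_def)

lemma is_hom_zero: assumes "is_hom h" shows "h 0 = 0"
  using is_hom_add[OF assms, of 0 0] by simp

lemma is_hom_uminus: assumes "is_hom h" shows "h (- a) = - h a"
  using is_hom_add[OF assms, of a "- a"] is_hom_zero[OF assms] by (simp add: eq_neg_iff_add_eq_0 add.commute)

lemma is_hom_diff: assumes "is_hom h" shows "h (a - b) = h a - h b"
  using is_hom_add[OF assms, of a "- b"] is_hom_uminus[OF assms] by simp

lemma is_hom_power: "is_hom h \<Longrightarrow> h (a ^ n) = h a ^ n"
  by (induction n) (simp_all add: is_hom_one is_hom_mult)

lemmas is_hom_simps =
  is_hom_zero is_hom_one is_hom_add is_hom_mult is_hom_uminus is_hom_diff is_hom_power

lemma is_hom_comp: "is_hom f \<Longrightarrow> is_hom g \<Longrightarrow> is_hom (\<lambda>a. f (g a))"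
  by (simp add: is_hom_def)

lemma is_hom_const_poly: "is_hom (\<lambda>a. [:a:])"
  by (rule is_homI) (simp_all add: one_pCons)

text \<open>The universal property of the polynomial ring: the extension of \<open>h\<close> that
  sends the variable to \<open>a\<close>. Nesting it evaluates in several variables.\<close>

definition ev :: "('a::comm_ring_1 \<Rightarrow> 'b::comm_ring_1) \<Rightarrow> 'b \<Rightarrow> 'a poly \<Rightarrow> 'b" where
  "ev h a p = poly (map_poly h p) a"

lemma ev_0 [simp]: "ev h a 0 = 0"
  by (simp add: ev_def)

lemma ev_pCons: "is_hom h \<Longrightarrow> ev h a (pCons c p) = h c + a * ev h a p"
  by (simp add: ev_def map_poly_pCons is_hom_zero)

lemma ev_const: "is_hom h \<Longrightarrow> ev h a [:c:] = h c"
  by (simp add: ev_pCons)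

lemma ev_var: "is_hom h \<Longrightarrow> ev h a [:0, 1:] = a"
  by (simp add: ev_pCons is_hom_simps)

lemma ev_add: "is_hom h \<Longrightarrow> ev h a (p + q) = ev h a p + ev h a q"
proof (induction p arbitrary: q)
  case (pCons c p)
  obtain b q' where "q = pCons b q'" by (cases q)
  then show ?case using pCons.IH[of q'] pCons.prems
    by (simp add: ev_pCons is_hom_add algebra_simps)
qed simp

lemma ev_smult: "is_hom h \<Longrightarrow> ev h a (smult c p) = h c * ev h a p"
  by (induction p) (simp_all add: ev_pCons is_hom_simps algebra_simps)

lemma is_hom_ev: assumes h: "is_hom h" shows "is_hom (ev h a)"
proof (rule is_homI)
  show "ev h a 1 = 1" by (simp add: one_pCons ev_const[OF h] is_hom_one[OF h])
  show "ev h a (p + q) = ev h a p + ev h a q" for p q by (rule ev_add[OF h])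
  show "ev h a (p * q) = ev h a p * ev h a q" for p q
    by (induction p) (simp_all add: ev_pCons[OF h] ev_add[OF h] ev_smult[OF h] is_hom_zero[OF h] algebra_simps)
qed

lemma map_poly_eq_ev:
  assumes h: "is_hom h" shows "map_poly h p = ev (\<lambda>c. [:h c:]) [:0, 1:] p"
proof -
  have "is_hom (\<lambda>c. [:h c:])" by (rule is_hom_comp[OF is_hom_const_poly h])
  then show ?thesis
    by (induction p) (simp_all add: map_poly_pCons is_hom_zero[OF h] ev_pCons)
qed

lemma is_hom_map_poly: assumes h: "is_hom h" shows "is_hom (map_poly h)"
proof -
  have "map_poly h = ev (\<lambda>c. [:h c:]) [:0, 1:]"
    by (rule ext) (rule map_poly_eq_ev[OF h])
  then show ?thesis
    using is_hom_ev[OF is_hom_comp[OF is_hom_const_poly h]] by simp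
qed

text \<open>Horner's scheme builds every polynomial from constants and the variable by sums and
  products.\<close>

lemma poly_generator_induct:
  fixes p :: "'a::comm_ring_1 poly"
  assumes "\<And>a. S [:a:]" "S [:0, 1:]" "\<And>p q. S p \<Longrightarrow> S q \<Longrightarrow> S (p + q)"
    "\<And>p q. S p \<Longrightarrow> S q \<Longrightarrow> S (p * q)"
  shows "S p"
proof (induction p)
  case 0
  show ?case using assms(1)[of 0] by simp
next
  case (pCons a p)
  have "pCons a p = [:a:] + [:0, 1:] * p" by simp
  then show ?case using assms(3)[OF assms(1) assms(4)[OF assms(2) pCons.IH]] by metis
qed

lemma is_hom_ext_poly:
  assumes f: "is_hom f" and g: "is_hom g"
    and "\<And>a. f [:a:] = g [:a:]" "f [:0, 1:] = g [:0, 1:]"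
  shows "f p = g p"
  by (rule poly_generator_induct[of "\<lambda>p. f p = g p"]) (simp_all add: assms is_hom_simps[OF f] is_hom_simps[OF g])

text \<open>Remainders are tracked inside an arbitrary subring \<open>A\<close>, because the same
  expansions are later needed in two subrings whose equality is still to be shown.\<close>

definition is_subring :: "'a::comm_ring_1 set \<Rightarrow> bool" where
  "is_subring A \<longleftrightarrow> 1 \<in> A \<and> (\<forall>a\<in>A. \<forall>b\<in>A. a - b \<in> A \<and> a * b \<in> A)"

lemma is_subring_one: "is_subring A \<Longrightarrow> 1 \<in> A"
  and is_subring_diff: "is_subring A \<Longrightarrow> a \<in> A \<Longrightarrow> b \<in> A \<Longrightarrow> a - b \<in> A"
  and is_subring_mult: "is_subring A \<Longrightarrow> a \<in> A \<Longrightarrow> b \<in> A \<Longrightarrow> a * b \<in> A"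
  by (auto simp: is_subring_def)

lemma is_subring_zero: assumes "is_subring A" shows "0 \<in> A"
  using is_subring_diff[OF assms is_subring_one[OF assms] is_subring_one[OF assms]] by simp

lemma is_subring_uminus: assumes "is_subring A" "a \<in> A" shows "- a \<in> A"
  using is_subring_diff[OF assms(1) is_subring_zero[OF assms(1)] assms(2)] by simp

lemma is_subring_add: assumes "is_subring A" "a \<in> A" "b \<in> A" shows "a + b \<in> A"
  using is_subring_diff[OF assms(1,2) is_subring_uminus[OF assms(1,3)]] by simp

lemma is_subring_power: "is_subring A \<Longrightarrow> a \<in> A \<Longrightarrow> a ^ n \<in> A"
  by (induction n) (simp_all add: is_subring_one is_subring_mult)

lemmas is_subring_intros = is_subring_zero is_subring_one is_subring_add is_subring_mult
  is_subring_uminus is_subring_diff is_subring_power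

lemma is_subring_range: "is_hom h \<Longrightarrow> is_subring (range h)"
  unfolding is_subring_def
  by (metis (no_types, lifting) is_hom_one is_hom_diff is_hom_mult rangeE rangeI)

lemma ev_in_subring:
  assumes "is_hom h" "is_subring A" "\<And>c. h c \<in> A" "a \<in> A"
  shows "ev h a p \<in> A"
  by (induction p) (simp_all add: ev_pCons assms is_subring_intros)

text \<open>Stopping at first order avoids factorials, so the expansion holds in every
  characteristic.\<close>

lemma ev_taylor:
  assumes h: "is_hom h" and A: "is_subring A" "\<And>c. h c \<in> A" and a: "a \<in> A" and b: "b \<in> A"
  shows "\<exists>q\<in>A. ev h (a + b) p = ev h a p + b * ev h a (pderiv p) + b ^ 2 * q"
proof (induction p)
  case 0
  show ?case using is_subring_zero[OF A(1)] by (intro bexI[of _ 0]) simp_all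
next
  case (pCons c p)
  then obtain q where q: "q \<in> A" "ev h (a + b) p = ev h a p + b * ev h a (pderiv p) + b ^ 2 * q"
    by blast
  show ?case
  proof (rule bexI)
    \<comment> \<open>Multiply the expansion of \<open>p\<close> by \<open>a + b\<close>: the terms
      linear in \<open>b\<close> give the product rule for \<open>pderiv\<close>, and those with
      \<open>b ^ 2\<close> form the new remainder.\<close>
    show "ev h (a + b) (pCons c p) = ev h a (pCons c p) + b * ev h a (pderiv (pCons c p)) +
        b ^ 2 * (ev h a (pderiv p) + (a + b) * q)"
      by (simp add: ev_pCons[OF h] pderiv_pCons ev_add[OF h] q(2) is_hom_zero[OF h] algebra_simps power2_eq_square)
    show "ev h a (pderiv p) + (a + b) * q \<in> A"
      by (intro is_subring_intros A ev_in_subring[OF h] a b q)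
  qed
qed

text \<open>Congruences modulo \<open>u\<close> between coefficients pass to values. The map
  \<open>g\<close> on coefficients is the identity when an inner variable is moved, and the
  substitution \<open>X = 0\<close> when reducing modulo \<open>x\<close>.\<close>

lemma ev_cong_mod:
  assumes h: "is_hom h" and h': "is_hom h'" and A: "is_subring A" "\<And>c. h c \<in> A" and a: "a \<in> A"
    and g: "g 0 = 0" and cong: "\<And>c. \<exists>q\<in>A. h c = h' (g c) + u * q"
  shows "\<exists>q\<in>A. ev h a p = ev h' a (map_poly g p) + u * q"
proof (induction p)
  case 0
  show ?case using is_subring_zero[OF A(1)] by (intro bexI[of _ 0]) simp_all
next
  case (pCons c p)
  then obtain q where q: "q \<in> A" "ev h a p = ev h' a (map_poly g p) + u * q" by blast
  obtain q' where q': "q' \<in> A" "h c = h' (g c) + u * q'" using cong by blast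
  have "ev h a (pCons c p) = ev h' a (map_poly g (pCons c p)) + u * (q' + a * q)"
    by (simp add: ev_pCons[OF h] ev_pCons[OF h'] map_poly_pCons g q(2) q'(2) algebra_simps)
  then show ?case using A(1) a q q' by (blast intro: is_subring_intros)
qed

section \<open>Taylor expansion of the defining equations\<close>

text \<open>Arguments run from the innermost variable outwards. The same notation later serves other
  variable lists: \<open>ev2 \<iota> z y\<close> for k[Z,Y] and \<open>ev3 \<iota> x z w\<close> for
  k[X,Z,W].\<close>

abbreviation ev2 :: "('k::comm_ring_1 \<Rightarrow> 'l::comm_ring_1) \<Rightarrow> 'l \<Rightarrow> 'l \<Rightarrow> 'k poly poly \<Rightarrow> 'l" where
  "ev2 \<iota> x z \<equiv> ev (ev \<iota> x) z"

abbreviation ev3 :: "('k::comm_ring_1 \<Rightarrow> 'l::comm_ring_1) \<Rightarrow> 'l \<Rightarrow> 'l \<Rightarrow> 'l \<Rightarrow> 'k poly poly poly \<Rightarrow> 'l" where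
  "ev3 \<iota> x z y \<equiv> ev (ev2 \<iota> x z) y"

lemma map_poly_ident: "map_poly (\<lambda>c. c) p = p"
  by (simp add: map_poly_def)

text \<open>Expand P at \<open>z\<close> and divide by \<open>x ^ d\<close>: the linear term leaves
  \<open>x ^ n * w\<close> times P', and the quadratic term keeps a further factor
  \<open>x ^ (d + n)\<close>, which is divisible by \<open>x\<close> since \<open>d \<ge> 1\<close>.
  Only the difference of \<open>y\<close> and \<open>y'\<close> is described, so membership of
  either in \<open>A\<close> yields that of the other.\<close>

lemma translate_y:
  fixes x :: "'l::idom"
  assumes \<iota>: "is_hom \<iota>" and A: "is_subring A" "\<And>c. \<iota> c \<in> A"
    and xzw: "x \<in> A" "z \<in> A" "w \<in> A" and "x \<noteq> 0" and "d \<ge> 1"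
    and y: "x ^ d * y = ev2 \<iota> x z P" and y': "x ^ d * y' = ev2 \<iota> x z' P"
    and z': "z' = z + x ^ (d + n) * w"
  shows "\<exists>q\<in>A. y' = y + x ^ n * (w * ev2 \<iota> x z (pderiv P) + x * q)"
proof -
  have hom: "is_hom (ev \<iota> x)" and mem: "ev \<iota> x c \<in> A" for c
    by (intro is_hom_ev \<iota>) (intro ev_in_subring \<iota> A xzw)
  have "x ^ (d + n) * w \<in> A" by (intro is_subring_intros A xzw)
  from ev_taylor[OF hom A(1) mem xzw(2) this, of P]
  obtain q where q: "q \<in> A" "ev2 \<iota> x z' P = ev2 \<iota> x z P
      + x ^ (d + n) * w * ev2 \<iota> x z (pderiv P) + (x ^ (d + n) * w) ^ 2 * q"
    unfolding z' by blast
  have m: "x ^ (d + n) = x * x ^ (d + n - 1)" using \<open>d \<ge> 1\<close> by (cases d) simp_all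
  have "x ^ d * y' = x ^ d * (y + x ^ n * (w * ev2 \<iota> x z (pderiv P) + x * (x ^ (d + n - 1) * w ^ 2 * q)))"
  proof -
    have "(x ^ (d + n) * w) ^ 2 = x ^ d * x ^ n * (x * x ^ (d + n - 1)) * w ^ 2"
      by (subst m[symmetric]) (simp add: power_add power2_eq_square)
    then show ?thesis
      by (simp only: y' q(2) distrib_left y) (simp add: power_add algebra_simps)
  qed
  then have "y' = y + x ^ n * (w * ev2 \<iota> x z (pderiv P) + x * (x ^ (d + n - 1) * w ^ 2 * q))"
    using \<open>x \<noteq> 0\<close> by simp
  moreover have "x ^ (d + n - 1) * w ^ 2 * q \<in> A" by (intro is_subring_intros A xzw q)
  ultimately show ?thesis by blast
qed

text \<open>Here \<open>n\<close> is e - 1. Passing from \<open>y2\<close> to \<open>y1\<close>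
  changes Q by \<open>x ^ n * c\<close> times Q' up to \<open>x ^ (2 * n)\<close>, and passing from
  \<open>z2\<close> to \<open>z1\<close> changes it by a multiple of \<open>x ^ (d + n)\<close>.
  After division by \<open>x ^ n\<close> only \<open>t2\<close> and the linear term survive modulo
  \<open>x\<close>, because \<open>d\<close> and \<open>n\<close> are positive.\<close>

lemma translate_t:
  fixes x :: "'l::idom"
  assumes \<iota>: "is_hom \<iota>" and A: "is_subring A" "\<And>c. \<iota> c \<in> A"
    and mem: "x \<in> A" "z2 \<in> A" "y2 \<in> A" "w \<in> A" and "x \<noteq> 0" and "d \<ge> 1" and "n \<ge> 1"
    and y1: "x ^ d * y1 = ev2 \<iota> x z1 P" and y2: "x ^ d * y2 = ev2 \<iota> x z2 P"
    and t1: "x ^ Suc n * t1 = ev3 \<iota> x z1 y1 Q" and t2: "x ^ n * t2 = ev3 \<iota> x z2 y2 Q"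
    and z1: "z1 = z2 - x ^ (d + n) * w"
  shows "\<exists>q\<in>A. x * t1 = t2 - w * (ev2 \<iota> x z2 (pderiv P) * ev3 \<iota> x z2 y2 (pderiv Q)) + x * q"
proof -
  define P' where "P' = ev2 \<iota> x z2 (pderiv P)"
  define Q' where "Q' = ev3 \<iota> x z2 y2 (pderiv Q)"
  note hom1 = is_hom_ev[OF \<iota>, of x]
  note hom2 = is_hom_ev[OF hom1]
  have mem1: "ev \<iota> x c \<in> A" for c by (intro ev_in_subring \<iota> A mem)
  have mem2: "ev2 \<iota> x b c \<in> A" if "b \<in> A" for b c by (intro ev_in_subring hom1 A mem1 that)
  have z1': "z1 = z2 + x ^ (d + n) * (- w)" using z1 by simp
  have P'A: "P' \<in> A" and Q'A: "Q' \<in> A"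
    unfolding P'_def Q'_def by (intro mem2 mem) (intro ev_in_subring hom2 A mem2 mem)
  have z1A: "z1 \<in> A" unfolding z1 by (intro is_subring_intros A mem)
  obtain q1 where q1: "q1 \<in> A" "y1 = y2 + x ^ n * (- w * P' + x * q1)"
    using translate_y[OF \<iota> A mem(1,2) is_subring_uminus[OF A(1) mem(4)] \<open>x \<noteq> 0\<close> \<open>d \<ge> 1\<close> y2 y1 z1']
    unfolding P'_def by blast
  \<comment> \<open>This is \<open>(y1 - y2) / x ^ n\<close>, congruent to \<open>- w * P'\<close>
    modulo \<open>x\<close>.\<close>
  define c where "c = - w * P' + x * q1"
  have cA: "c \<in> A" unfolding c_def by (intro is_subring_intros A mem P'A q1)
  have "x ^ n * c \<in> A" by (intro is_subring_intros A mem cA)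
  from ev_taylor[OF hom2 A(1) mem2[OF z1A] mem(3) this, of Q]
  obtain q3 where q3: "q3 \<in> A" "ev3 \<iota> x z1 y1 Q = ev3 \<iota> x z1 y2 Q
      + x ^ n * c * ev3 \<iota> x z1 y2 (pderiv Q) + (x ^ n * c) ^ 2 * q3"
    unfolding q1(2) c_def by blast
  have shift: "\<exists>q\<in>A. ev2 \<iota> x z1 f = ev2 \<iota> x z2 f + x ^ (d + n) * q" for f
  proof -
    have "x ^ (d + n) * (- w) \<in> A" by (intro is_subring_intros A mem)
    from ev_taylor[OF hom1 A(1) mem1 mem(2) this, of f]
    obtain q where q: "q \<in> A" "ev2 \<iota> x z1 f = ev2 \<iota> x z2 f
      + x ^ (d + n) * (- w) * ev2 \<iota> x z2 (pderiv f) + (x ^ (d + n) * (- w)) ^ 2 * q"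
      unfolding z1' by blast
    show ?thesis
    proof (rule bexI)
      show "ev2 \<iota> x z1 f = ev2 \<iota> x z2 f + x ^ (d + n) * (- w * ev2 \<iota> x z2 (pderiv f) + x ^ (d + n) * w ^ 2 * q)"
        unfolding q(2) by (simp add: algebra_simps power2_eq_square)
      show "- w * ev2 \<iota> x z2 (pderiv f) + x ^ (d + n) * w ^ 2 * q \<in> A"
        by (intro is_subring_intros A mem mem2 q)
    qed
  qed
  \<comment> \<open>The shift of \<open>z\<close> acts on the coefficients of a polynomial in Y,
    hence the identity as coefficient map.\<close>
  have shiftQ: "\<exists>q\<in>A. ev3 \<iota> x z1 y2 f = ev3 \<iota> x z2 y2 f + x ^ (d + n) * q" for f
    using ev_cong_mod[where g = "\<lambda>c. c", OF hom2 hom2 A(1) mem2[OF z1A] mem(3) refl shift]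
    by (simp only: map_poly_ident)
  obtain q4 where q4: "q4 \<in> A" "ev3 \<iota> x z1 y2 Q = ev3 \<iota> x z2 y2 Q + x ^ (d + n) * q4"
    using shiftQ by blast
  obtain q5 where q5: "q5 \<in> A" "ev3 \<iota> x z1 y2 (pderiv Q) = Q' + x ^ (d + n) * q5"
    unfolding Q'_def using shiftQ by blast
  \<comment> \<open>All terms that retain a factor \<open>x\<close> after division by
    \<open>x ^ n\<close>, with that factor removed.\<close>
  define q where "q = q1 * Q' + x ^ (d - 1) * q4 + c * x ^ (d - 1) * x ^ n * q5 + x ^ (n - 1) * c ^ 2 * q3"
  have d: "x ^ (d + n) = x ^ n * (x * x ^ (d - 1))"
    using \<open>d \<ge> 1\<close> by (cases d) (simp_all add: power_add)
  have n: "(x ^ n * c) ^ 2 = x ^ n * (x * x ^ (n - 1)) * c ^ 2"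
    using \<open>n \<ge> 1\<close> by (cases n) (simp_all add: power2_eq_square)
  have "x ^ n * (x * t1) = x ^ n * (t2 - w * (P' * Q') + x * q)"
  proof -
    have "x ^ n * (x * t1) = ev3 \<iota> x z1 y1 Q" using t1 by (simp add: mult_ac)
    also have "\<dots> = x ^ n * t2 + x ^ (d + n) * q4 + x ^ n * c * (Q' + x ^ (d + n) * q5) + (x ^ n * c) ^ 2 * q3"
      unfolding q3(2) q4(2) q5(2) t2 ..
    also have "\<dots> = x ^ n * (t2 + x * x ^ (d - 1) * q4 + c * Q' + x * (c * x ^ (d - 1) * x ^ n * q5 + x ^ (n - 1) * c ^ 2 * q3))"
      unfolding d n by (simp add: algebra_simps)
    also have "c * Q' = - w * (P' * Q') + x * (q1 * Q')" by (simp add: c_def algebra_simps)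
    finally show ?thesis by (simp add: q_def algebra_simps)
  qed
  then have "x * t1 = t2 - w * (P' * Q') + x * q" using \<open>x \<noteq> 0\<close> by simp
  moreover have "q \<in> A" unfolding q_def
    by (intro is_subring_intros A mem q1 q3 q4 q5 cA Q'A)
  ultimately show ?thesis unfolding P'_def Q'_def by blast
qed

section \<open>Reduction modulo \<open>x\<close> of values, and invertibility of the
  derivatives\<close>

lemma ev_at_0:
  assumes \<iota>: "is_hom \<iota>" and A: "is_subring A" "\<And>c. \<iota> c \<in> A" and x: "x \<in> A"
  shows "\<exists>q\<in>A. ev \<iota> x p = \<iota> (poly p 0) + x * q"
proof (cases p)
  case (pCons c p')
  then show ?thesis
    using ev_in_subring[OF \<iota> A x, of p'] by (auto simp: ev_pCons[OF \<iota>])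
qed

text \<open>Putting \<open>X = 0\<close> deletes the innermost variable, so \<open>z\<close> becomes
  innermost on the right. The congruence is lifted one variable at a time.\<close>

lemma ev2_at_X0:
  assumes \<iota>: "is_hom \<iota>" and A: "is_subring A" "\<And>c. \<iota> c \<in> A" and x: "x \<in> A" and z: "z \<in> A"
  shows "\<exists>q\<in>A. ev2 \<iota> x z p = ev \<iota> z (P_at_X0 p) + x * q"
  unfolding P_at_X0_def
  by (rule ev_cong_mod[OF is_hom_ev[OF \<iota>] \<iota> A(1) ev_in_subring[OF \<iota> A x] z])
    (simp_all add: ev_at_0[OF \<iota> A x])

lemma P_at_X0_0: "P_at_X0 0 = 0"
  by (simp add: P_at_X0_def)

lemma ev3_at_X0:
  assumes \<iota>: "is_hom \<iota>" and A: "is_subring A" "\<And>c. \<iota> c \<in> A"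
    and x: "x \<in> A" and z: "z \<in> A" and y: "y \<in> A"
  shows "\<exists>q\<in>A. ev3 \<iota> x z y p = ev2 \<iota> z y (Q_at_X0 p) + x * q"
  unfolding Q_at_X0_def
  by (rule ev_cong_mod[OF is_hom_ev[OF is_hom_ev[OF \<iota>]] is_hom_ev[OF \<iota>] A(1)
        ev_in_subring[OF is_hom_ev[OF \<iota>] A(1) ev_in_subring[OF \<iota> A x] z] y])
    (simp_all add: ev2_at_X0[OF \<iota> A x z] P_at_X0_0)

text \<open>As \<open>d\<close> and \<open>n\<close> are positive, the relations for
  \<open>y\<close> and \<open>t\<close> make P(0,z) and Q(0,y,z) multiples of \<open>x\<close> in
  \<open>A\<close>. The two Bezout identities thus say that \<open>v\<close> inverts P' and
  \<open>c\<close> inverts Q' modulo \<open>x\<close>.\<close>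

lemma slope_unit_mod_x:
  assumes \<iota>: "is_hom \<iota>" and A: "is_subring A" "\<And>c. \<iota> c \<in> A"
    and mem: "x \<in> A" "z \<in> A" "y \<in> A" "t \<in> A" and "d \<ge> 1" "n \<ge> 1"
    and y: "x ^ d * y = ev2 \<iota> x z P" and t: "x ^ n * t = ev3 \<iota> x z y Q"
    and uv: "u * P_at_X0 P + v * P_at_X0 (pderiv P) = 1"
    and abc: "a * [:P_at_X0 P:] + b * Q_at_X0 Q + c * Q_at_X0 (pderiv Q) = 1"
  shows "\<exists>k\<in>A. ev2 \<iota> z y c * ev \<iota> z v * (ev2 \<iota> x z (pderiv P) * ev3 \<iota> x z y (pderiv Q)) = 1 + x * k"
proof -
  note hom1 = is_hom_ev[OF \<iota>, of z]
  note hom2 = is_hom_ev[OF hom1, of y]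
  have mem1: "ev \<iota> z p \<in> A" for p by (intro ev_in_subring \<iota> A mem)
  have mem2: "ev2 \<iota> z y p \<in> A" for p by (intro ev_in_subring hom1 A mem1 mem)
  obtain q1 where q1: "q1 \<in> A" "ev2 \<iota> x z P = ev \<iota> z (P_at_X0 P) + x * q1"
    using ev2_at_X0[OF \<iota> A mem(1,2)] by blast
  obtain q2 where q2: "q2 \<in> A" "ev2 \<iota> x z (pderiv P) = ev \<iota> z (P_at_X0 (pderiv P)) + x * q2"
    using ev2_at_X0[OF \<iota> A mem(1,2)] by blast
  obtain q3 where q3: "q3 \<in> A" "ev3 \<iota> x z y Q = ev2 \<iota> z y (Q_at_X0 Q) + x * q3"
    using ev3_at_X0[OF \<iota> A mem(1,2,3)] by blast
  obtain q4 where q4: "q4 \<in> A" "ev3 \<iota> x z y (pderiv Q) = ev2 \<iota> z y (Q_at_X0 (pderiv Q)) + x * q4"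
    using ev3_at_X0[OF \<iota> A mem(1,2,3)] by blast
  \<comment> \<open>\<open>p\<close> and \<open>q\<close> are the quotients of P(0,z) and Q(0,y,z)
    by \<open>x\<close>.\<close>
  define p where "p = x ^ (d - 1) * y - q1"
  define q where "q = x ^ (n - 1) * t - q3"
  have p: "ev \<iota> z (P_at_X0 P) = x * p"
    using q1(2) y \<open>d \<ge> 1\<close> by (cases d) (simp_all add: p_def algebra_simps)
  have q: "ev2 \<iota> z y (Q_at_X0 Q) = x * q"
    using q3(2) t \<open>n \<ge> 1\<close> by (cases n) (simp_all add: q_def algebra_simps)
  have pA: "p \<in> A" and qA: "q \<in> A"
    unfolding p_def q_def by (intro is_subring_intros A mem q1 q3)+
  have 1: "ev \<iota> z v * ev \<iota> z (P_at_X0 (pderiv P)) = 1 - x * (ev \<iota> z u * p)"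
  proof -
    have "ev \<iota> z (u * P_at_X0 P + v * P_at_X0 (pderiv P)) = 1"
      using uv is_hom_one[OF hom1] by simp
    then show ?thesis by (simp add: is_hom_simps[OF hom1] p algebra_simps)
  qed
  have 2: "ev2 \<iota> z y c * ev2 \<iota> z y (Q_at_X0 (pderiv Q)) = 1 - x * (ev2 \<iota> z y a * p + ev2 \<iota> z y b * q)"
  proof -
    have "ev2 \<iota> z y (a * [:P_at_X0 P:] + b * Q_at_X0 Q + c * Q_at_X0 (pderiv Q)) = 1"
      using abc is_hom_one[OF hom2] by simp
    then show ?thesis by (simp add: is_hom_simps[OF hom2] ev_const[OF hom1] ev_smult[OF hom1] p q algebra_simps)
  qed
  \<comment> \<open>\<open>k1\<close> and \<open>k2\<close> are the errors of the two separate
    inversions; multiplying \<open>1 + x * k1\<close> by \<open>1 + x * k2\<close> gives the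
    combined error.\<close>
  define k1 where "k1 = ev \<iota> z v * q2 - ev \<iota> z u * p"
  define k2 where "k2 = ev2 \<iota> z y c * q4 - (ev2 \<iota> z y a * p + ev2 \<iota> z y b * q)"
  have k1: "ev \<iota> z v * ev2 \<iota> x z (pderiv P) = 1 + x * k1"
    using 1 by (simp add: q2(2) k1_def algebra_simps)
  have k2: "ev2 \<iota> z y c * ev3 \<iota> x z y (pderiv Q) = 1 + x * k2"
    using 2 by (simp add: q4(2) k2_def algebra_simps)
  have "ev2 \<iota> z y c * ev \<iota> z v * (ev2 \<iota> x z (pderiv P) * ev3 \<iota> x z y (pderiv Q))
     = (ev \<iota> z v * ev2 \<iota> x z (pderiv P)) * (ev2 \<iota> z y c * ev3 \<iota> x z y (pderiv Q))"
    by (simp only: mult_ac)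
  also have "\<dots> = 1 + x * (k1 + k2 + x * k1 * k2)"
    unfolding k1 k2 by (simp add: algebra_simps)
  finally have eq: "ev2 \<iota> z y c * ev \<iota> z v * (ev2 \<iota> x z (pderiv P) * ev3 \<iota> x z y (pderiv Q))
    = 1 + x * (k1 + k2 + x * k1 * k2)" .
  have "k1 + k2 + x * k1 * k2 \<in> A"
    unfolding k1_def k2_def by (intro is_subring_intros A mem mem1 mem2 pA qA q2 q4)
  with eq show ?thesis by blast
qed

section \<open>Quotients and their polynomial rings\<close>

abbreviation type_ring :: "'a::comm_ring_1 ring" where
  "type_ring \<equiv> ring_of_type_algebra"

lemma type_ring_simps:
  "carrier type_ring = UNIV" "x \<otimes>\<^bsub>type_ring\<^esub> y = x * y" "\<one>\<^bsub>type_ring\<^esub> = 1"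
  "\<zero>\<^bsub>type_ring\<^esub> = 0" "x \<oplus>\<^bsub>type_ring\<^esub> y = x + y"
  by (simp_all add: ring_of_type_algebra_def)

lemma finsum_type_ring:
  fixes f :: "'b \<Rightarrow> 'a::comm_ring_1"
  assumes "finite S" shows "finsum type_ring f S = sum f S"
proof -
  interpret R: cring "type_ring :: 'a ring" by (rule cring_from_type_algebra)
  show ?thesis using assms
    by (induction S) (simp_all add: type_ring_simps)
qed

lemma ideal_type_ringD:
  assumes "ideal I (type_ring :: 'a::comm_ring_1 ring)"
  shows "0 \<in> I" "\<And>a b. a \<in> I \<Longrightarrow> b \<in> I \<Longrightarrow> a + b \<in> I"
    "\<And>a b. b \<in> I \<Longrightarrow> a * b \<in> I" "\<And>a b. a \<in> I \<Longrightarrow> b \<in> I \<Longrightarrow> a - b \<in> I"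
proof -
  interpret I: ideal I "type_ring :: 'a ring" by fact
  show "0 \<in> I" using additive_subgroup.zero_closed[OF ideal.axioms(1)[OF assms]] by (simp add: type_ring_simps)
  show add: "a + b \<in> I" if "a \<in> I" "b \<in> I" for a b
    using additive_subgroup.a_closed[OF ideal.axioms(1)[OF assms] that] by (simp add: type_ring_simps)
  show mult: "a * b \<in> I" if "b \<in> I" for a b
    using I.I_l_closed[OF that, of a] by (simp add: type_ring_simps)
  show "a - b \<in> I" if "a \<in> I" "b \<in> I" for a b
    using add[OF that(1) mult[OF that(2), of "-1"]] by simp
qed

lemma ideal_type_ringI:
  fixes I :: "'a::comm_ring_1 set"
  assumes "0 \<in> I" "\<And>a b. a \<in> I \<Longrightarrow> b \<in> I \<Longrightarrow> a + b \<in> I" "\<And>a b. b \<in> I \<Longrightarrow> a * b \<in> I"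
  shows "ideal I type_ring"
proof -
  interpret R: cring "type_ring :: 'a ring" by (rule cring_from_type_algebra)
  have "\<ominus>\<^bsub>type_ring\<^esub> x = - x" for x :: 'a
    by (rule R.minus_equality) (simp_all add: type_ring_simps)
  then have minus: "\<ominus>\<^bsub>type_ring\<^esub> x \<in> I" if "x \<in> I" for x
    using assms(3)[OF that, of "-1"] by simp
  have "subgroup I (add_monoid (type_ring :: 'a ring))"
    by (rule R.add.subgroupI)
      (use assms minus in \<open>auto simp: type_ring_simps a_inv_def[symmetric]\<close>)
  then show ?thesis
    by (rule idealI[OF R.ring_axioms]) (use assms(3) in \<open>auto simp: type_ring_simps mult.commute\<close>)
qed

lemma Idl_pair:
  fixes f g :: "'a::comm_ring_1"
  shows "Idl\<^bsub>type_ring\<^esub> {f, g} = {a * f + b * g | a b. True}"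
proof
  interpret R: cring "type_ring :: 'a ring" by (rule cring_from_type_algebra)
  have I: "ideal {a * f + b * g | a b. True} type_ring"
  proof (rule ideal_type_ringI)
    show "0 \<in> {a * f + b * g | a b. True}" by (auto intro!: exI[of _ 0])
    show "p + q \<in> {a * f + b * g | a b. True}"
      if pq: "p \<in> {a * f + b * g | a b. True}" "q \<in> {a * f + b * g | a b. True}" for p q
    proof -
      obtain a b a' b' where "p = a * f + b * g" "q = a' * f + b' * g" using pq by blast
      then have "p + q = (a + a') * f + (b + b') * g" by (simp add: algebra_simps)
      then show ?thesis by blast
    qed
    show "p * q \<in> {a * f + b * g | a b. True}" if q: "q \<in> {a * f + b * g | a b. True}" for p q
    proof -
      obtain a b where "q = a * f + b * g" using q by blast
      then have "p * q = (p * a) * f + (p * b) * g" by (simp add: algebra_simps)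
      then show ?thesis by blast
    qed
  qed
  have "f = 1 * f + 0 * g" "g = 0 * f + 1 * g" by simp_all
  then have "{f, g} \<subseteq> {a * f + b * g | a b. True}" by blast
  then show "Idl\<^bsub>type_ring\<^esub> {f, g} \<subseteq> {a * f + b * g | a b. True}"
    by (rule R.genideal_minimal[OF I])
  have J: "ideal (Idl\<^bsub>type_ring\<^esub> {f, g}) type_ring" "{f, g} \<subseteq> Idl\<^bsub>type_ring\<^esub> {f, g}"
    by (intro R.genideal_ideal R.genideal_self; simp add: type_ring_simps)+
  then show "{a * f + b * g | a b. True} \<subseteq> Idl\<^bsub>type_ring\<^esub> {f, g}"
    using ideal_type_ringD(2,3)[OF J(1)] by auto
qed

text \<open>This inclusion extracts Bezout coefficients from a unit ideal with three
  generators.\<close>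

lemma Idl_triple_subset:
  fixes f g h :: "'a::comm_ring_1"
  shows "Idl\<^bsub>type_ring\<^esub> {f, g, h} \<subseteq> {a * f + b * g + c * h | a b c. True}"
proof -
  interpret R: cring "type_ring :: 'a ring" by (rule cring_from_type_algebra)
  have I: "ideal {a * f + b * g + c * h | a b c. True} type_ring"
  proof (rule ideal_type_ringI)
    show "0 \<in> {a * f + b * g + c * h | a b c. True}" by (auto intro!: exI[of _ 0])
    show "p + q \<in> {a * f + b * g + c * h | a b c. True}"
      if pq: "p \<in> {a * f + b * g + c * h | a b c. True}" "q \<in> {a * f + b * g + c * h | a b c. True}" for p q
    proof -
      obtain a b c a' b' c' where "p = a * f + b * g + c * h" "q = a' * f + b' * g + c' * h"
        using pq by blast
      then have "p + q = (a + a') * f + (b + b') * g + (c + c') * h" by (simp add: algebra_simps)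
      then show ?thesis by blast
    qed
    show "p * q \<in> {a * f + b * g + c * h | a b c. True}"
      if q: "q \<in> {a * f + b * g + c * h | a b c. True}" for p q
    proof -
      obtain a b c where "q = a * f + b * g + c * h" using q by blast
      then have "p * q = (p * a) * f + (p * b) * g + (p * c) * h" by (simp add: algebra_simps)
      then show ?thesis by blast
    qed
  qed
  have "f = 1 * f + 0 * g + 0 * h" "g = 0 * f + 1 * g + 0 * h" "h = 0 * f + 0 * g + 1 * h" by simp_all
  then have "{f, g, h} \<subseteq> {a * f + b * g + c * h | a b c. True}" by blast
  then show ?thesis by (rule R.genideal_minimal[OF I])
qed

lemma coset_eq_iff:
  assumes "ideal I (type_ring :: 'a::comm_ring_1 ring)"
  shows "I +>\<^bsub>type_ring\<^esub> a = I +>\<^bsub>type_ring\<^esub> b \<longleftrightarrow> a - b \<in> I"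
proof -
  note I = ideal_type_ringD[OF assms]
  have coset: "I +>\<^bsub>type_ring\<^esub> c = (\<lambda>i. i + c) ` I" for c
    by (auto simp: a_r_coset_def' type_ring_simps)
  show ?thesis
  proof
    assume "I +>\<^bsub>type_ring\<^esub> a = I +>\<^bsub>type_ring\<^esub> b"
    then have "0 + a \<in> (\<lambda>i. i + b) ` I" using I(1) unfolding coset by blast
    then show "a - b \<in> I" by auto
  next
    assume ab: "a - b \<in> I"
    have "i + a \<in> (\<lambda>i. i + b) ` I" if "i \<in> I" for i
      using I(2)[OF that ab] by (auto intro!: image_eqI[of _ _ "i + (a - b)"])
    moreover have "i + b \<in> (\<lambda>i. i + a) ` I" if "i \<in> I" for i
      using I(4)[OF that ab] by (auto intro!: image_eqI[of _ _ "i - (a - b)"])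
    ultimately show "I +>\<^bsub>type_ring\<^esub> a = I +>\<^bsub>type_ring\<^esub> b"
      unfolding coset by blast
  qed
qed

text \<open>Elements of \<open>UP\<close> are coefficient functions of finite support. This map
  reduces coefficients modulo \<open>I\<close> and carries results on type-level polynomials over to
  the polynomial ring of the quotient.\<close>

definition coset_poly :: "'a::comm_ring_1 set \<Rightarrow> 'a poly \<Rightarrow> nat \<Rightarrow> 'a set" where
  "coset_poly I p n = I +>\<^bsub>type_ring\<^esub> coeff p n"

lemma coset_poly_eq_iff:
  assumes "ideal I type_ring"
  shows "coset_poly I p = coset_poly I q \<longleftrightarrow> (\<forall>n. coeff (p - q) n \<in> I)"
  by (simp add: fun_eq_iff coset_poly_def coset_eq_iff[OF assms])

lemma coset_poly_hom:
  fixes I :: "'a::comm_ring_1 set"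
  assumes I: "ideal I type_ring"
  shows coset_poly_carrier: "coset_poly I p \<in> carrier (UP (type_ring Quot I))"
    and coset_poly_add: "coset_poly I (p + q) = coset_poly I p \<oplus>\<^bsub>UP (type_ring Quot I)\<^esub> coset_poly I q"
    and coset_poly_mult: "coset_poly I (p * q) = coset_poly I p \<otimes>\<^bsub>UP (type_ring Quot I)\<^esub> coset_poly I q"
    and coset_poly_one: "coset_poly I 1 = \<one>\<^bsub>UP (type_ring Quot I)\<^esub>"
    and coset_poly_const: "coset_poly I [:a:] = up_ring.monom (UP (type_ring Quot I)) (I +>\<^bsub>type_ring\<^esub> a) 0"
proof -
  interpret I: ideal I "type_ring :: 'a ring" by fact
  interpret H: ring_hom_ring "type_ring :: 'a ring" "type_ring Quot I" "(+>\<^bsub>type_ring\<^esub>) I"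
    by (rule I.rcos_ring_hom_ring)
  have zero: "I +>\<^bsub>type_ring\<^esub> 0 = \<zero>\<^bsub>type_ring Quot I\<^esub>" using H.hom_zero by (simp add: type_ring_simps)
  have one: "I +>\<^bsub>type_ring\<^esub> 1 = \<one>\<^bsub>type_ring Quot I\<^esub>" using H.hom_one by (simp add: type_ring_simps)
  have closed: "I +>\<^bsub>type_ring\<^esub> c \<in> carrier (type_ring Quot I)" for c
    using H.hom_closed by (simp add: type_ring_simps)
  have add: "I +>\<^bsub>type_ring\<^esub> (a + b)
    = (I +>\<^bsub>type_ring\<^esub> a) \<oplus>\<^bsub>type_ring Quot I\<^esub> (I +>\<^bsub>type_ring\<^esub> b)" for a b
    using H.hom_add[of a b] by (simp add: type_ring_simps)
  have mult: "I +>\<^bsub>type_ring\<^esub> (a * b)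
    = (I +>\<^bsub>type_ring\<^esub> a) \<otimes>\<^bsub>type_ring Quot I\<^esub> (I +>\<^bsub>type_ring\<^esub> b)" for a b
    using H.hom_mult[of a b] by (simp add: type_ring_simps)
  have in_up: "coset_poly I p \<in> up (type_ring Quot I)" for p
  proof -
    have "bound \<zero>\<^bsub>type_ring Quot I\<^esub> (degree p) (coset_poly I p)"
      by (rule bound.intro) (simp add: coset_poly_def coeff_eq_0 zero)
    then show ?thesis using closed by (auto simp: up_def coset_poly_def)
  qed
  then show "coset_poly I p \<in> carrier (UP (type_ring Quot I))" by (simp add: UP_def)
  show "coset_poly I (p + q) = coset_poly I p \<oplus>\<^bsub>UP (type_ring Quot I)\<^esub> coset_poly I q"
    by (simp add: UP_def in_up) (simp add: coset_poly_def add fun_eq_iff)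
  show "coset_poly I 1 = \<one>\<^bsub>UP (type_ring Quot I)\<^esub>"
    by (auto simp: UP_def coset_poly_def fun_eq_iff zero one)
  show "coset_poly I [:a:] = up_ring.monom (UP (type_ring Quot I)) (I +>\<^bsub>type_ring\<^esub> a) 0"
    by (auto simp: UP_def coset_poly_def fun_eq_iff zero closed coeff_pCons split: nat.splits)
  show "coset_poly I (p * q) = coset_poly I p \<otimes>\<^bsub>UP (type_ring Quot I)\<^esub> coset_poly I q"
  proof
    fix n
    have "coset_poly I (p * q) n = I +>\<^bsub>type_ring\<^esub> (\<Oplus>\<^bsub>type_ring\<^esub>i\<in>{..n}. coeff p i * coeff q (n - i))"
      by (simp add: coset_poly_def coeff_mult finsum_type_ring)
    also have "\<dots> = (\<Oplus>\<^bsub>type_ring Quot I\<^esub>i\<in>{..n}. I +>\<^bsub>type_ring\<^esub> (coeff p i * coeff q (n - i)))"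
      by (subst H.hom_finsum) (auto simp: type_ring_simps o_def)
    also have "\<dots> = (\<Oplus>\<^bsub>type_ring Quot I\<^esub>i\<in>{..n}. coset_poly I p i \<otimes>\<^bsub>type_ring Quot I\<^esub> coset_poly I q (n - i))"
      by (simp add: coset_poly_def mult)
    finally show "coset_poly I (p * q) n = (coset_poly I p \<otimes>\<^bsub>UP (type_ring Quot I)\<^esub> coset_poly I q) n"
      by (simp add: UP_def in_up)
  qed
qed

lemma coset_poly_surj:
  assumes I: "ideal I type_ring" and f: "f \<in> carrier (UP (type_ring Quot I))"
  shows "\<exists>p. coset_poly I p = f"
proof -
  interpret I: ideal I "type_ring :: 'a ring" by fact
  interpret H: ring_hom_ring "type_ring :: 'a ring" "type_ring Quot I" "(+>\<^bsub>type_ring\<^esub>) I"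
    by (rule I.rcos_ring_hom_ring)
  have zero: "I +>\<^bsub>type_ring\<^esub> 0 = \<zero>\<^bsub>type_ring Quot I\<^esub>" using H.hom_zero by (simp add: type_ring_simps)
  obtain N where N: "\<And>n. n > N \<Longrightarrow> f n = \<zero>\<^bsub>type_ring Quot I\<^esub>"
    using f by (auto simp: UP_def up_def bound_def)
  have "\<exists>a. f n = I +>\<^bsub>type_ring\<^esub> a" for n
  proof -
    have "f n \<in> carrier (type_ring Quot I)" using f by (auto simp: UP_def up_def)
    then show ?thesis by (auto simp: FactRing_def A_RCOSETS_def' type_ring_simps)
  qed
  then obtain a where a: "\<And>n. f n = I +>\<^bsub>type_ring\<^esub> a n" by metis
  \<comment> \<open>Beyond \<open>N\<close> the chosen representatives need only lie in
    \<open>I\<close>, not vanish, so the list stops at index \<open>N\<close>.\<close>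
  define p where "p = Poly (map a [0..<Suc N])"
  have "coeff p n = (if n \<le> N then a n else 0)" for n
    by (simp add: p_def nth_default_def del: upt_Suc)
  then have "coset_poly I p n = f n" for n
    using N[of n] a[of n] by (simp add: coset_poly_def zero)
  then show ?thesis by blast
qed

text \<open>By the first isomorphism theorem both polynomial rings are isomorphic to the common
  range of \<open>\<theta>\<close> and \<open>\<theta>'\<close>, and the isomorphism is the
  composite through it. The last conjunct evaluates it on representatives, as is needed for
  compatibility with scalars.\<close>

lemma UP_Quot_iso:
  fixes \<theta> \<theta>' :: "'a::comm_ring_1 poly \<Rightarrow> 'l::comm_ring_1"
  assumes I: "ideal I type_ring" and J: "ideal J type_ring"
    and \<theta>: "is_hom \<theta>" and \<theta>': "is_hom \<theta>'" and range: "range \<theta> = range \<theta>'"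
    and ker: "\<And>p. \<theta> p = 0 \<longleftrightarrow> (\<forall>n. coeff p n \<in> I)"
    and ker': "\<And>p. \<theta>' p = 0 \<longleftrightarrow> (\<forall>n. coeff p n \<in> J)"
  shows "\<exists>h \<in> ring_iso (UP (type_ring Quot I)) (UP (type_ring Quot J)).
    \<forall>p q. \<theta> p = \<theta>' q \<longrightarrow> h (coset_poly I p) = coset_poly J q"
proof -
  have eqI: "coset_poly I p = coset_poly I q \<longleftrightarrow> \<theta> p = \<theta> q" for p q
    unfolding coset_poly_eq_iff[OF I] ker[symmetric] is_hom_diff[OF \<theta>] by simp
  have eqJ: "coset_poly J p = coset_poly J q \<longleftrightarrow> \<theta>' p = \<theta>' q" for p q
    unfolding coset_poly_eq_iff[OF J] ker'[symmetric] is_hom_diff[OF \<theta>'] by simp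
  \<comment> \<open>The choice is harmless: by \<open>eqI\<close> and \<open>eqJ\<close> a class is
    determined by its value under \<open>\<theta>\<close> or \<open>\<theta>'\<close>.\<close>
  define h where "h f = coset_poly J (SOME q. \<exists>p. coset_poly I p = f \<and> \<theta> p = \<theta>' q)" for f
  have h: "h (coset_poly I p) = coset_poly J q" if pq: "\<theta> p = \<theta>' q" for p q
  proof -
    have "\<exists>q p'. coset_poly I p' = coset_poly I p \<and> \<theta> p' = \<theta>' q" using pq by blast
    from someI_ex[OF this] obtain p'
      where "coset_poly I p' = coset_poly I p"
        "\<theta> p' = \<theta>' (SOME q'. \<exists>p'. coset_poly I p' = coset_poly I p \<and> \<theta> p' = \<theta>' q')"
      by blast
    then show ?thesis unfolding h_def eqI eqJ using pq by simp
  qed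
  have ex: "\<exists>p q. f = coset_poly I p \<and> \<theta> p = \<theta>' q" if f: "f \<in> carrier (UP (type_ring Quot I))" for f
  proof -
    obtain p where "coset_poly I p = f" using coset_poly_surj[OF I f] ..
    moreover have "\<theta> p \<in> range \<theta>'" unfolding range[symmetric] by (rule rangeI)
    ultimately show ?thesis by auto
  qed
  have ex': "\<exists>p q. g = coset_poly J q \<and> \<theta> p = \<theta>' q" if g: "g \<in> carrier (UP (type_ring Quot J))" for g
  proof -
    obtain q where q: "coset_poly J q = g" using coset_poly_surj[OF J g] ..
    have "\<theta>' q \<in> range \<theta>" unfolding range by (rule rangeI)
    then obtain p where "\<theta>' q = \<theta> p" by (rule rangeE)
    then have "g = coset_poly J q \<and> \<theta> p = \<theta>' q" using q by simp
    then show ?thesis by (intro exI)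
  qed
  have hom: "h \<in> ring_hom (UP (type_ring Quot I)) (UP (type_ring Quot J))"
  proof (rule ring_hom_memI)
    fix f assume "f \<in> carrier (UP (type_ring Quot I))"
    from ex[OF this] obtain p q where pq: "f = coset_poly I p" "\<theta> p = \<theta>' q" by blast
    then show "h f \<in> carrier (UP (type_ring Quot J))" by (simp add: h coset_poly_carrier[OF J])
    fix g assume "g \<in> carrier (UP (type_ring Quot I))"
    from ex[OF this] obtain p' q' where pq': "g = coset_poly I p'" "\<theta> p' = \<theta>' q'" by blast
    have "\<theta> (p * p') = \<theta>' (q * q')" "\<theta> (p + p') = \<theta>' (q + q')"
      by (simp_all add: is_hom_simps[OF \<theta>] is_hom_simps[OF \<theta>'] pq pq')
    note hs = this[THEN h]
    show "h (f \<otimes>\<^bsub>UP (type_ring Quot I)\<^esub> g) = h f \<otimes>\<^bsub>UP (type_ring Quot J)\<^esub> h g"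
      using hs(1) by (simp add: pq pq' h[OF pq(2)] h[OF pq'(2)] coset_poly_mult[OF I] coset_poly_mult[OF J])
    show "h (f \<oplus>\<^bsub>UP (type_ring Quot I)\<^esub> g) = h f \<oplus>\<^bsub>UP (type_ring Quot J)\<^esub> h g"
      using hs(2) by (simp add: pq pq' h[OF pq(2)] h[OF pq'(2)] coset_poly_add[OF I] coset_poly_add[OF J])
  next
    show "h \<one>\<^bsub>UP (type_ring Quot I)\<^esub> = \<one>\<^bsub>UP (type_ring Quot J)\<^esub>"
      using h[of 1 1] by (simp add: is_hom_one[OF \<theta>] is_hom_one[OF \<theta>'] coset_poly_one[OF I] coset_poly_one[OF J])
  qed
  have "inj_on h (carrier (UP (type_ring Quot I)))"
  proof (rule inj_onI)
    fix f g assume f: "f \<in> carrier (UP (type_ring Quot I))" and g: "g \<in> carrier (UP (type_ring Quot I))"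
      and fg: "h f = h g"
    obtain p q where f: "f = coset_poly I p" and pq: "\<theta> p = \<theta>' q"
      using ex[OF f] by blast
    obtain p' q' where g: "g = coset_poly I p'" and pq': "\<theta> p' = \<theta>' q'"
      using ex[OF g] by blast
    show "f = g" using fg unfolding f g h[OF pq] h[OF pq'] eqI eqJ pq pq' .
  qed
  moreover have "carrier (UP (type_ring Quot J)) \<subseteq> h ` carrier (UP (type_ring Quot I))"
  proof
    fix g assume "g \<in> carrier (UP (type_ring Quot J))"
    from ex'[OF this] obtain p q where "g = coset_poly J q" "\<theta> p = \<theta>' q" by blast
    then show "g \<in> h ` carrier (UP (type_ring Quot I))"
      using h coset_poly_carrier[OF I] by (intro image_eqI[of _ _ "coset_poly I p"]) simp_all
  qed
  moreover have "h ` carrier (UP (type_ring Quot I)) \<subseteq> carrier (UP (type_ring Quot J))"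
    using ring_hom_closed[OF hom] by (rule image_subsetI)
  ultimately have "h \<in> ring_iso (UP (type_ring Quot I)) (UP (type_ring Quot J))"
    using hom by (simp add: ring_iso_def bij_betw_def subset_antisym)
  then show ?thesis by (rule bexI[rotated]) (use h in simp)
qed

section \<open>The defining ideal\<close>

text \<open>A monic polynomial is a nonzerodivisor modulo a constant. Writing
  \<open>f * g = c h\<close> and \<open>h = f q + r\<close> gives \<open>f (g - c q) = c r\<close>,
  where the right side has too small a degree unless both sides vanish.\<close>

lemma const_dvd_monic_mult:
  fixes f g :: "'a::idom poly"
  assumes f: "lead_coeff f = 1" and dvd: "[:c:] dvd f * g"
  shows "[:c:] dvd g"
proof -
  obtain h where h: "f * g = smult c h" using dvd by (auto elim!: dvdE)
  have f0: "f \<noteq> 0" using f by auto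
  \<comment> \<open>For monic \<open>f\<close> the scaling factor of pseudo-division is 1, so this
    is ordinary division with remainder.\<close>
  obtain q r where qr: "pseudo_divmod h f = (q, r)" by fastforce
  have h': "h = f * q + r" and r: "r = 0 \<or> degree r < degree f"
    using pseudo_divmod[OF f0 qr] f by simp_all
  have eq: "f * (g - smult c q) = smult c r"
    by (simp add: algebra_simps h h' smult_add_right)
  have "g - smult c q = 0"
  proof (rule ccontr)
    assume nz: "g - smult c q \<noteq> 0"
    then have "smult c r \<noteq> 0" using eq f0 by (metis no_zero_divisors)
    then have "degree r < degree f" using r by auto
    moreover have "degree (smult c r) \<ge> degree f"
      unfolding eq[symmetric] using f0 nz by (simp add: degree_mult_eq)
    moreover have "degree (smult c r) \<le> degree r" by (rule degree_smult_le)
    ultimately show False by linarith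
  qed
  then have "g = [:c:] * q" by simp
  then show ?thesis by (rule dvdI)
qed

text \<open>Lifts knowledge of a kernel from coefficients to polynomials; iterating it shows that
  the kernel of \<open>X = 0\<close> consists of multiples of X.\<close>

lemma const_dvd_of_map_poly_eq_0:
  fixes p :: "'a::idom poly"
  assumes "h 0 = 0" "\<And>c. h c = 0 \<Longrightarrow> u dvd c" "map_poly h p = 0"
  shows "[:u:] dvd p"
proof -
  have coeff0: "h (coeff p n) = 0" for n
    using arg_cong[OF assms(3), of "\<lambda>q. coeff q n"] by (simp add: coeff_map_poly assms(1))
  show ?thesis unfolding const_poly_dvd_iff by (intro allI assms(2) coeff0)
qed

lemma map_poly_section:
  assumes "s 0 = 0" "h 0 = 0" "\<And>c. h (s c) = c"
  shows "map_poly h (map_poly s p) = p"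
  by (rule poly_eqI) (simp add: coeff_map_poly assms)

section \<open>The substitution \<open>X = 0\<close> on the polynomial rings: homomorphism, kernel
  and surjectivity\<close>

lemma P_at_X0_eq: "P_at_X0 = map_poly (\<lambda>a. poly a 0)"
  by (rule ext) (simp add: P_at_X0_def)

lemma Q_at_X0_eq: "Q_at_X0 = map_poly P_at_X0"
  by (rule ext) (simp add: Q_at_X0_def)

lemma is_hom_P_at_X0: "is_hom P_at_X0"
  unfolding P_at_X0_eq by (rule is_hom_map_poly) (rule is_homI; simp)

lemma is_hom_Q_at_X0: "is_hom Q_at_X0"
  unfolding Q_at_X0_eq by (rule is_hom_map_poly[OF is_hom_P_at_X0])

definition at_X0 :: "'k::field poly poly poly poly \<Rightarrow> 'k poly poly poly" where
  "at_X0 = map_poly Q_at_X0"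

lemma is_hom_at_X0: "is_hom at_X0"
  unfolding at_X0_def by (rule is_hom_map_poly[OF is_hom_Q_at_X0])

lemma Q_at_X0_const: "Q_at_X0 [:p:] = [:P_at_X0 p:]"
  by (simp add: Q_at_X0_def map_poly_pCons is_hom_zero[OF is_hom_P_at_X0])

lemma at_X0_const: "at_X0 [:q:] = [:Q_at_X0 q:]"
  by (simp add: at_X0_def map_poly_pCons is_hom_zero[OF is_hom_Q_at_X0])

lemma at_X0_var_X: "at_X0 var_X = 0"
  by (simp add: var_X_def at_X0_const Q_at_X0_const) (simp add: P_at_X0_def map_poly_pCons)

lemma var_X_dvd_of_at_X0:
  assumes "at_X0 p = 0" shows "var_X dvd p"
proof -
  have 0: "[:0, 1:] dvd a" if "poly a 0 = 0" for a :: "'a poly"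
    using that by (simp add: poly_eq_0_iff_dvd)
  have 1: "[:[:0, 1:]:] dvd a" if "P_at_X0 a = 0" for a :: "'a poly poly"
    using that unfolding P_at_X0_def by (rule const_dvd_of_map_poly_eq_0[rotated 2]) (use 0 in auto)
  have 2: "[:[:[:0, 1:]:]:] dvd a" if "Q_at_X0 a = 0" for a :: "'a poly poly poly"
    using that unfolding Q_at_X0_def
    by (rule const_dvd_of_map_poly_eq_0[rotated 2]) (use 1 in \<open>auto simp: P_at_X0_0\<close>)
  show ?thesis
    using assms unfolding at_X0_def var_X_def
    by (rule const_dvd_of_map_poly_eq_0[rotated 2])
      (use 2 in \<open>auto simp: is_hom_zero[OF is_hom_Q_at_X0]\<close>)
qed

lemma at_X0_surj: "\<exists>c. at_X0 c = q"
proof -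
  \<comment> \<open>The sections \<open>s1\<close>, \<open>s2\<close>, \<open>s3\<close> regard a
    polynomial without X as one that is constant in X.\<close>
  define s1 :: "'a poly \<Rightarrow> 'a poly poly" where "s1 = map_poly (\<lambda>c. [:c:])"
  define s2 where "s2 = map_poly s1"
  define s3 where "s3 = map_poly s2"
  have 1: "P_at_X0 (s1 p) = p" for p
    unfolding P_at_X0_def s1_def by (rule map_poly_section) simp_all
  have 2: "Q_at_X0 (s2 p) = p" for p
    unfolding Q_at_X0_def s2_def by (rule map_poly_section) (simp_all add: 1 P_at_X0_0, simp add: s1_def)
  have "at_X0 (s3 q) = q"
    unfolding at_X0_def s3_def
    by (rule map_poly_section) (simp_all add: 2 is_hom_zero[OF is_hom_Q_at_X0], simp add: s2_def)
  then show ?thesis ..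
qed

lemma lead_coeff_Q_at_X0:
  assumes "lead_coeff Q = 1" shows "lead_coeff (Q_at_X0 Q) = 1"
proof -
  have "coeff (Q_at_X0 Q) (degree Q) = 1"
    using assms by (simp add: Q_at_X0_def coeff_map_poly P_at_X0_0 is_hom_one[OF is_hom_P_at_X0])
  moreover have "degree (Q_at_X0 Q) \<le> degree Q"
    by (rule degree_le) (simp add: Q_at_X0_def coeff_map_poly P_at_X0_0 coeff_eq_0)
  ultimately show ?thesis by (metis le_antisym le_degree zero_neq_one)
qed

lemma P_at_X0_nonzero:
  assumes "lead_coeff P = 1" shows "P_at_X0 P \<noteq> 0"
proof -
  have "coeff (P_at_X0 P) (degree P) = 1"
    using assms by (simp add: P_at_X0_def coeff_map_poly)
  then show ?thesis by auto
qed

lemma ideal_B_eq: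
  "ideal_B P Q d e = {a * (var_X ^ d * var_Y - [:[:P:]:]) + b * (var_X ^ e * var_T - [:Q:]) | a b. True}"
  by (simp add: ideal_B_def Idl_pair XZ_to_XZYT_def XZY_to_XZYT_def)

lemma ideal_B_ideal: "ideal (ideal_B P Q d e) type_ring"
proof -
  interpret R: cring "type_ring :: 'a poly poly poly poly ring" by (rule cring_from_type_algebra)
  show ?thesis unfolding ideal_B_def by (intro R.genideal_ideal) (simp add: type_ring_simps)
qed

text \<open>Modulo \<open>X\<close> the two generators become \<open>P(0,Z)\<close>, a nonzero constant of \<open>k[Z][Y]\<close>, and \<open>Q(0,Y,Z)\<close>,
  which is monic in \<open>Y\<close>; these form a regular sequence.\<close>
lemma ideal_B_cancel_var_X:
  fixes P :: "'k::field poly poly"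
  assumes P: "lead_coeff P = 1" and Q: "lead_coeff Q = 1" and "d \<ge> 1" "e \<ge> 1"
    and f: "var_X * f \<in> ideal_B P Q d e"
  shows "f \<in> ideal_B P Q d e"
proof -
  note hom = is_hom_simps[OF is_hom_at_X0]
  define F where "F = var_X ^ d * var_Y - [:[:P:]:]"
  define G where "G = var_X ^ e * var_T - [:Q:]"
  have I: "ideal_B P Q d e = {a * F + b * G | a b. True}" unfolding ideal_B_eq F_def G_def ..
  define u where "u = [:[:P_at_X0 P:]:]"
  define v where "v = [:Q_at_X0 Q:]"
  have F0: "at_X0 F = - u" and G0: "at_X0 G = - v"
    using \<open>d \<ge> 1\<close> \<open>e \<ge> 1\<close>
    by (simp_all only: F_def G_def u_def v_def hom at_X0_var_X at_X0_const Q_at_X0_const)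
      (simp_all add: power_0_left)
  obtain a b where ab: "var_X * f = a * F + b * G" using f I by blast
  have eq: "at_X0 a * u + at_X0 b * v = 0"
  proof -
    have "at_X0 var_X * at_X0 f = at_X0 a * at_X0 F + at_X0 b * at_X0 G"
      using arg_cong[OF ab, of at_X0] unfolding hom .
    then show ?thesis unfolding at_X0_var_X F0 G0 by (simp add: add_eq_0_iff)
  qed
  \<comment> \<open>Compare coefficients of powers of T, in which \<open>u\<close> and
    \<open>v\<close> are constant. The product of Q(0,Y,Z) and a coefficient of b at
    \<open>X = 0\<close> is divisible by P(0,Z), and Q(0,Y,Z) is monic in Y.\<close>
  have "[:P_at_X0 P:] dvd coeff (at_X0 b) n" for n
  proof -
    have "coeff (at_X0 a * u + at_X0 b * v) n = 0"
      unfolding eq by simp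
    then have "Q_at_X0 Q * coeff (at_X0 b) n = [:P_at_X0 P:] * (- coeff (at_X0 a) n)"
      by (simp add: u_def v_def eq_neg_iff_add_eq_0 add.commute)
    then have "[:P_at_X0 P:] dvd Q_at_X0 Q * coeff (at_X0 b) n" by (rule dvdI)
    then show ?thesis by (rule const_dvd_monic_mult[OF lead_coeff_Q_at_X0[OF Q]])
  qed
  then have "u dvd at_X0 b" by (simp add: u_def const_poly_dvd_iff)
  then obtain c0 where c0: "at_X0 b = u * c0" by (rule dvdE)
  \<comment> \<open>At \<open>X = 0\<close> the pair \<open>(a, b)\<close> is \<open>c0\<close>
    times the trivial relation \<open>(- v, u)\<close>. Lifting \<open>c0\<close> to
    \<open>c\<close> and replacing \<open>(a, b)\<close> by \<open>(a - G * c, b + F * c)\<close>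
    keeps the combination of \<open>F\<close> and \<open>G\<close> and makes both coefficients
    divisible by X.\<close>
  obtain c where c: "at_X0 c = c0" using at_X0_surj by blast
  have "at_X0 (b + F * c) = 0" by (simp add: hom c0 c F0)
  then obtain b' where b': "b + F * c = var_X * b'" by (rule var_X_dvd_of_at_X0[THEN dvdE])
  have "u * (at_X0 a + c0 * v) = 0"
    using eq unfolding c0 by (simp add: algebra_simps)
  moreover have "u \<noteq> 0" using P_at_X0_nonzero[OF P] by (simp add: u_def)
  ultimately have "at_X0 a + c0 * v = 0" by simp
  then have "at_X0 (a - G * c) = 0" by (simp add: hom c G0 mult.commute)
  then obtain a' where a': "a - G * c = var_X * a'" by (rule var_X_dvd_of_at_X0[THEN dvdE])
  have "var_X * f = (a - G * c) * F + (b + F * c) * G" unfolding ab by (simp add: algebra_simps)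
  also have "\<dots> = var_X * (a' * F + b' * G)" unfolding a' b' by (simp add: algebra_simps)
  finally have "var_X * f = var_X * (a' * F + b' * G)" .
  moreover have "var_X \<noteq> (0 :: 'k poly poly poly poly)" by (simp add: var_X_def)
  ultimately have "f = a' * F + b' * G" by (simp only: mult_cancel_left) simp
  then show ?thesis unfolding I by blast
qed

lemma ideal_B_cancel_var_X_power:
  fixes P :: "'k::field poly poly"
  assumes "lead_coeff P = 1" "lead_coeff Q = 1" "d \<ge> 1" "e \<ge> 1" "var_X ^ N * f \<in> ideal_B P Q d e"
  shows "f \<in> ideal_B P Q d e"
  using assms(5) by (induction N) (auto simp: mult.assoc intro: ideal_B_cancel_var_X[OF assms(1-4)])

text \<open>After inverting X the relations give Y = P / X^d and T = Q / X^e, so a power of X moves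
  any element into k[X,Z] modulo the ideal. The elements with this property contain the generators
  and are closed under sums and products.\<close>

lemma ideal_B_reduce:
  fixes c :: "'k::field poly poly poly poly"
  shows "\<exists>N c'. var_X ^ N * c - [:[:c':]:] \<in> ideal_B P Q d e"
proof -
  define I where "I = ideal_B P Q d e"
  note I = ideal_type_ringD[OF ideal_B_ideal[of P Q d e], folded I_def]
  define E :: "'k poly poly \<Rightarrow> 'k poly poly poly poly" where "E c = [:[:c:]:]" for c
  have E: "is_hom E" unfolding E_def by (rule is_hom_comp[OF is_hom_const_poly is_hom_const_poly])
  define \<xi> :: "'k poly poly" where "\<xi> = [:[:0, 1:]:]"
  have \<xi>: "var_X = E \<xi>" by (simp add: var_X_def E_def \<xi>_def)
  define S where "S c \<longleftrightarrow> (\<exists>N c'. var_X ^ N * c - E c' \<in> I)" for c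
  have S_add: "S (a + b)" if ab: "S a" "S b" for a b
  proof -
    obtain M a' N b' where a': "var_X ^ M * a - E a' \<in> I" and b': "var_X ^ N * b - E b' \<in> I"
      using ab unfolding S_def by blast
    have "var_X ^ (M + N) * (a + b) - E (\<xi> ^ N * a' + \<xi> ^ M * b')
      = var_X ^ N * (var_X ^ M * a - E a') + var_X ^ M * (var_X ^ N * b - E b')"
      by (simp add: \<xi> is_hom_simps[OF E] power_add algebra_simps)
    also have "\<dots> \<in> I" by (intro I a' b')
    finally show ?thesis unfolding S_def by blast
  qed
  have S_mult: "S (a * b)" if ab: "S a" "S b" for a b
  proof -
    obtain M a' N b' where a': "var_X ^ M * a - E a' \<in> I" and b': "var_X ^ N * b - E b' \<in> I"
      using ab unfolding S_def by blast
    have "var_X ^ (M + N) * (a * b) - E (a' * b')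
      = (var_X ^ N * b) * (var_X ^ M * a - E a') + E a' * (var_X ^ N * b - E b')"
      by (simp add: is_hom_simps[OF E] power_add algebra_simps)
    also have "\<dots> \<in> I" by (intro I a' b')
    finally show ?thesis unfolding S_def by blast
  qed
  have S_const: "S (E a)" for a
  proof -
    have "var_X ^ 0 * E a - E a \<in> I" using I(1) by simp
    then show ?thesis unfolding S_def by blast
  qed
  have FG: "var_X ^ d * var_Y - [:[:P:]:] \<in> I" "var_X ^ e * var_T - [:Q:] \<in> I"
    unfolding I_def ideal_B_eq
    by (rule CollectI, rule exI[of _ 1], rule exI[of _ 0], simp)
      (rule CollectI, rule exI[of _ 0], rule exI[of _ 1], simp)
  have S_Y: "S var_Y" unfolding S_def using FG(1) unfolding E_def by blast
  have S_XZY: "S [:q:]" for q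
  proof (rule poly_generator_induct[of "\<lambda>q. S [:q:]"])
    show "S [:[:a:]:]" for a using S_const[of a] by (simp add: E_def)
    show "S [:[:0, 1:]:]" using S_Y by (simp add: var_Y_def)
    show "S [:p + q:]" if "S [:p:]" "S [:q:]" for p q using S_add[OF that] by simp
    show "S [:p * q:]" if "S [:p:]" "S [:q:]" for p q using S_mult[OF that] by (simp add: mult.commute)
  qed
  \<comment> \<open>\<open>X ^ e * T\<close> is congruent to Q, which lies in k[X,Z,Y] and is
    already covered by \<open>S_XZY\<close>.\<close>
  have S_T: "S var_T"
  proof -
    obtain M c' where c': "var_X ^ M * [:Q:] - E c' \<in> I" using S_XZY[of Q] unfolding S_def by blast
    have "var_X ^ (M + e) * var_T - E c'
      = var_X ^ M * (var_X ^ e * var_T - [:Q:]) + (var_X ^ M * [:Q:] - E c')"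
      by (simp only: power_add right_diff_distrib mult.assoc) simp
    also have "\<dots> \<in> I" by (intro I FG c')
    finally show ?thesis unfolding S_def by blast
  qed
  have "S c"
    by (rule poly_generator_induct[of S, OF S_XZY S_T[unfolded var_T_def] S_add S_mult])
  then show ?thesis unfolding S_def I_def E_def .
qed

text \<open>One exponent serves all the finitely many coefficients: exponents are added, and each
  part is rescaled by the power of X belonging to the other.\<close>

lemma ideal_B_reduce_poly:
  fixes p :: "'k::field poly poly poly poly poly"
  shows "\<exists>N p'. \<forall>n. var_X ^ N * coeff p n - [:[:coeff p' n:]:] \<in> ideal_B P Q d e"
proof (induction p)
  case 0
  show ?case using ideal_type_ringD(1)[OF ideal_B_ideal, of P Q d e]
    by (intro exI[of _ 0]) simp
next
  case (pCons c p)
  note I = ideal_type_ringD[OF ideal_B_ideal[of P Q d e]]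
  define \<xi> :: "'k poly poly" where "\<xi> = [:[:0, 1:]:]"
  have \<xi>: "var_X ^ k = [:[:\<xi> ^ k:]:]" for k
    unfolding var_X_def \<xi>_def by (simp add: poly_const_pow)
  obtain M p' where p': "\<And>n. var_X ^ M * coeff p n - [:[:coeff p' n:]:] \<in> ideal_B P Q d e"
    using pCons.IH by blast
  obtain N c' where c': "var_X ^ N * c - [:[:c':]:] \<in> ideal_B P Q d e"
    using ideal_B_reduce by blast
  have "var_X ^ (M + N) * coeff (pCons c p) n - [:[:coeff (pCons (\<xi> ^ M * c') (smult (\<xi> ^ N) p')) n:]:]
    \<in> ideal_B P Q d e" for n
  proof (cases n)
    case 0
    have "var_X ^ M * (var_X ^ N * c - [:[:c':]:]) \<in> ideal_B P Q d e" by (intro I c')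
    also have "var_X ^ M * (var_X ^ N * c - [:[:c':]:]) = var_X ^ (M + N) * c - [:[:\<xi> ^ M * c':]:]"
      by (simp add: \<xi> power_add right_diff_distrib)
    finally show ?thesis by (simp add: 0)
  next
    case (Suc m)
    have "var_X ^ N * (var_X ^ M * coeff p m - [:[:coeff p' m:]:]) \<in> ideal_B P Q d e" by (intro I p')
    also have "var_X ^ N * (var_X ^ M * coeff p m - [:[:coeff p' m:]:])
      = var_X ^ (M + N) * coeff p m - [:[:\<xi> ^ N * coeff p' m:]:]"
      by (simp add: \<xi> power_add right_diff_distrib mult_ac)
    finally show ?thesis by (simp add: Suc)
  qed
  then show ?case by blast
qed

lemma ev_map_poly:
  assumes "g 0 = 0" "is_hom h"
  shows "ev h a (map_poly g p) = ev (\<lambda>c. h (g c)) a p"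
  by (simp add: ev_def map_poly_map_poly assms is_hom_zero o_def)

text \<open>The kernel of evaluation contains no relations beyond those of B. A power of X moves
  \<open>p\<close> into k[X,Z][W] modulo the ideal; there independence of \<open>x\<close>,
  \<open>z\<close>, \<open>w\<close> forces zero, and the power of X can be cancelled.\<close>

lemma ev_eq_0_iff_ideal_B:
  fixes P :: "'k::field poly poly" and x :: "'l::idom"
  assumes P: "lead_coeff P = 1" and Q: "lead_coeff Q = 1" and de: "d \<ge> 1" "e \<ge> 1"
    and \<iota>: "is_hom \<iota>" and "x \<noteq> 0"
    and y: "x ^ d * y = ev2 \<iota> x z P" and t: "x ^ e * t = ev3 \<iota> x z y Q"
    and indep: "\<And>p. ev3 \<iota> x z w p = 0 \<Longrightarrow> p = 0"
  shows "ev (ev (ev3 \<iota> x z y) t) w p = 0 \<longleftrightarrow> (\<forall>n. coeff p n \<in> ideal_B P Q d e)"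
proof -
  note hom1 = is_hom_ev[OF \<iota>, of x]
  note hom2 = is_hom_ev[OF hom1, of z]
  note hom3 = is_hom_ev[OF hom2, of y]
  note hom4 = is_hom_ev[OF hom3, of t]
  define h where "h = ev (ev3 \<iota> x z y) t"
  have h: "is_hom h" unfolding h_def by (rule hom4)
  have gens: "h [:[:c:]:] = ev2 \<iota> x z c" "h [:q:] = ev3 \<iota> x z y q" "h var_T = t" "h var_Y = y" "h var_X = x" for c q
    by (simp_all add: h_def var_T_def var_Y_def var_X_def ev_const[OF hom3] ev_const[OF hom2]
        ev_const[OF hom1] ev_var[OF hom3] ev_var[OF hom2] ev_var[OF hom1] ev_var[OF \<iota>])
  have I0: "h c = 0" if "c \<in> ideal_B P Q d e" for c
    using that by (auto simp: ideal_B_eq is_hom_simps[OF h] gens(1) gens(2)[of Q] gens(3-5) y t)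
  have ker: "ev h w p = 0" if "\<forall>n. coeff p n \<in> ideal_B P Q d e" for p
  proof -
    have "map_poly h p = 0"
      by (rule poly_eqI) (simp add: coeff_map_poly is_hom_zero[OF h] I0 that)
    then show ?thesis by (simp add: ev_def)
  qed
  moreover have "\<forall>n. coeff p n \<in> ideal_B P Q d e" if p: "ev h w p = 0"
  proof -
    obtain N p' where p': "\<And>n. var_X ^ N * coeff p n - [:[:coeff p' n:]:] \<in> ideal_B P Q d e"
      using ideal_B_reduce_poly by blast
    define p'' where "p'' = map_poly (\<lambda>c. [:[:c:]:] :: 'k poly poly poly poly) p'"
    have "ev h w (smult (var_X ^ N) p - p'') = 0"
      by (rule ker) (use p' in \<open>simp add: p''_def coeff_map_poly\<close>)
    then have "ev h w p'' = 0"
      by (simp add: is_hom_diff[OF is_hom_ev[OF h]] ev_smult[OF h] p)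
    then have "ev3 \<iota> x z w p' = 0"
      by (simp add: p''_def ev_map_poly h gens(1))
    then have "p' = 0" by (rule indep)
    then have "var_X ^ N * coeff p n \<in> ideal_B P Q d e" for n using p'[of n] by simp
    then show ?thesis using ideal_B_cancel_var_X_power[OF P Q de] by blast
  qed
  ultimately show ?thesis unfolding h_def by iprover
qed

section \<open>The common subring\<close>

text \<open>The outermost variable W is the one adjoined to B; the range is the subring
  k[x,z,y,t,w].\<close>

abbreviation ev5 ::
    "('k::comm_ring_1 \<Rightarrow> 'l::comm_ring_1) \<Rightarrow> 'l \<Rightarrow> 'l \<Rightarrow> 'l \<Rightarrow> 'l \<Rightarrow> 'l \<Rightarrow> 'k poly poly poly poly poly \<Rightarrow> 'l"
  where "ev5 \<iota> x z y t w \<equiv> ev (ev (ev3 \<iota> x z y) t) w"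

lemma is_hom_ev5: "is_hom \<iota> \<Longrightarrow> is_hom (ev5 \<iota> x z y t w)"
  by (intro is_hom_ev)

lemma ev5_simps:
  assumes \<iota>: "is_hom \<iota>"
  shows "ev5 \<iota> x z y t w [:[:[:[:[:c:]:]:]:]:] = \<iota> c" "ev5 \<iota> x z y t w [:[:[:[:[:0, 1:]:]:]:]:] = x"
    "ev5 \<iota> x z y t w [:[:[:[:0, 1:]:]:]:] = z" "ev5 \<iota> x z y t w [:[:[:0, 1:]:]:] = y"
    "ev5 \<iota> x z y t w [:[:0, 1:]:] = t" "ev5 \<iota> x z y t w [:0, 1:] = w"
proof -
  note hom1 = is_hom_ev[OF \<iota>, of x]
  note hom2 = is_hom_ev[OF hom1, of z]
  note hom3 = is_hom_ev[OF hom2, of y]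
  note hom4 = is_hom_ev[OF hom3, of t]
  note simps = ev_const[OF hom4] ev_const[OF hom3] ev_const[OF hom2] ev_const[OF hom1] ev_const[OF \<iota>]
    ev_var[OF hom4] ev_var[OF hom3] ev_var[OF hom2] ev_var[OF hom1] ev_var[OF \<iota>]
  show "ev5 \<iota> x z y t w [:[:[:[:[:c:]:]:]:]:] = \<iota> c" "ev5 \<iota> x z y t w [:[:[:[:[:0, 1:]:]:]:]:] = x"
    "ev5 \<iota> x z y t w [:[:[:[:0, 1:]:]:]:] = z" "ev5 \<iota> x z y t w [:[:[:0, 1:]:]:] = y"
    "ev5 \<iota> x z y t w [:[:0, 1:]:] = t" "ev5 \<iota> x z y t w [:0, 1:] = w"
    by (simp_all only: simps)
qed

lemma range_ev5_subset:
  assumes \<iota>: "is_hom \<iota>" and A: "is_subring A" "\<And>c. \<iota> c \<in> A"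
    and "x \<in> A" "z \<in> A" "y \<in> A" "t \<in> A" "w \<in> A"
  shows "range (ev5 \<iota> x z y t w) \<subseteq> A"
proof (rule image_subsetI)
  fix p
  show "ev5 \<iota> x z y t w p \<in> A"
    by (intro ev_in_subring is_hom_ev assms)
qed

text \<open>Each ring is shown to contain the generators of the other, by solving
  \<open>x * t1 = t2 - w * \<beta> + x * q\<close>, \<open>\<alpha> * \<beta> = 1 + x * k\<close>
  and \<open>x * w' = \<alpha> * t2 - w\<close> in either direction and cancelling
  \<open>x\<close>.\<close>

lemma range_ev5_eq:
  fixes x :: "'l::idom"
  assumes \<iota>: "is_hom \<iota>" and "x \<noteq> 0" and "d \<ge> 1" and "n \<ge> 1"
    and y1: "x ^ d * y1 = ev2 \<iota> x z1 P" and y2: "x ^ d * y2 = ev2 \<iota> x z2 P"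
    and t1: "x ^ Suc n * t1 = ev3 \<iota> x z1 y1 Q" and t2: "x ^ n * t2 = ev3 \<iota> x z2 y2 Q"
    and z1: "z1 = z2 - x ^ (d + n) * w"
    and uv: "u * P_at_X0 P + v * P_at_X0 (pderiv P) = 1"
    and abc: "a * [:P_at_X0 P:] + b * Q_at_X0 Q + c * Q_at_X0 (pderiv Q) = 1"
    and w': "x * w' = ev2 \<iota> z2 y2 c * ev \<iota> z2 v * t2 - w"
  shows "range (ev5 \<iota> x z1 y1 t1 w) = range (ev5 \<iota> x z2 y2 t2 w')"
proof
  define \<alpha> where "\<alpha> = ev2 \<iota> z2 y2 c * ev \<iota> z2 v"
  define \<beta> where "\<beta> = ev2 \<iota> x z2 (pderiv P) * ev3 \<iota> x z2 y2 (pderiv Q)"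
  have w': "x * w' = \<alpha> * t2 - w" using w' unfolding \<alpha>_def .
  have closed: "\<alpha> \<in> A" "\<beta> \<in> A"
    if A: "is_subring A" "\<And>c. \<iota> c \<in> A" and "x \<in> A" "z2 \<in> A" "y2 \<in> A" for A
    unfolding \<alpha>_def \<beta>_def by (intro is_subring_mult ev_in_subring is_hom_ev \<iota> that)+
  \<comment> \<open>Both congruences are kept general in \<open>A\<close>, so that each inclusion
    obtains \<open>q\<close> and \<open>k\<close> in its own ring.\<close>
  have \<beta>: "\<exists>q\<in>A. x * t1 = t2 - w * \<beta> + x * q"
    if A: "is_subring A" "\<And>c. \<iota> c \<in> A" and "x \<in> A" "z2 \<in> A" "y2 \<in> A" "w \<in> A" for A
    unfolding \<beta>_def
    by (rule translate_t[OF \<iota> that \<open>x \<noteq> 0\<close> \<open>d \<ge> 1\<close> \<open>n \<ge> 1\<close> y1 y2 t1 t2 z1])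
  have \<alpha>: "\<exists>k\<in>A. \<alpha> * \<beta> = 1 + x * k"
    if A: "is_subring A" "\<And>c. \<iota> c \<in> A" and "x \<in> A" "z2 \<in> A" "y2 \<in> A" "t2 \<in> A" for A
    unfolding \<alpha>_def \<beta>_def
    by (rule slope_unit_mod_x[OF \<iota> that \<open>d \<ge> 1\<close> \<open>n \<ge> 1\<close> y2 t2 uv abc])
  show "range (ev5 \<iota> x z2 y2 t2 w') \<subseteq> range (ev5 \<iota> x z1 y1 t1 w)"
  proof -
    define A where "A = range (ev5 \<iota> x z1 y1 t1 w)"
    have A: "is_subring A" unfolding A_def by (rule is_subring_range[OF is_hom_ev5[OF \<iota>]])
    have mem: "\<iota> c \<in> A" "x \<in> A" "z1 \<in> A" "y1 \<in> A" "t1 \<in> A" "w \<in> A" for c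
      unfolding A_def by (rule range_eqI, rule ev5_simps[OF \<iota>, symmetric])+
    have z2: "z2 = z1 + x ^ (d + n) * w" unfolding z1 by simp
    have z2A: "z2 \<in> A" unfolding z2 by (intro is_subring_intros A mem)
    obtain q1 where q1: "q1 \<in> A" "y2 = y1 + x ^ n * (w * ev2 \<iota> x z1 (pderiv P) + x * q1)"
      using translate_y[OF \<iota> A mem(1,2,3,6) \<open>x \<noteq> 0\<close> \<open>d \<ge> 1\<close> y1 y2 z2] by blast
    have y2A: "y2 \<in> A" unfolding q1(2)
      by (intro is_subring_intros ev_in_subring is_hom_ev \<iota> A mem q1)
    note \<alpha>\<beta>A = closed[OF A mem(1,2) z2A y2A]
    obtain q where q: "q \<in> A" "x * t1 = t2 - w * \<beta> + x * q" using \<beta>[OF A mem(1,2) z2A y2A mem(6)] by blast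
    have t2_eq: "t2 = x * t1 + w * \<beta> - x * q" using q(2) by simp
    have t2A: "t2 \<in> A" unfolding t2_eq by (intro is_subring_intros A mem \<alpha>\<beta>A q)
    obtain k where k: "k \<in> A" "\<alpha> * \<beta> = 1 + x * k" using \<alpha>[OF A mem(1,2) z2A y2A t2A] by blast
    \<comment> \<open>Since \<open>\<alpha> * \<beta> = 1 + x * k\<close>, the terms in
      \<open>w\<close> combine to \<open>x * w * k\<close>, which makes the division by
      \<open>x\<close> possible inside \<open>A\<close>.\<close>
    have "x * w' = \<alpha> * x * t1 + w * (\<alpha> * \<beta>) - \<alpha> * x * q - w"
      unfolding w' t2_eq by (simp add: algebra_simps)
    also have "\<dots> = x * (\<alpha> * t1 - \<alpha> * q + w * k)" unfolding k(2) by (simp add: algebra_simps)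
    finally have "w' = \<alpha> * t1 - \<alpha> * q + w * k" using \<open>x \<noteq> 0\<close> by simp
    then have w'A: "w' \<in> A" by (simp only:) (intro is_subring_intros A mem \<alpha>\<beta>A q k)
    show ?thesis
      unfolding A_def[symmetric] by (rule range_ev5_subset[OF \<iota> A mem(1,2) z2A y2A t2A w'A])
  qed
  show "range (ev5 \<iota> x z1 y1 t1 w) \<subseteq> range (ev5 \<iota> x z2 y2 t2 w')"
  proof -
    define A where "A = range (ev5 \<iota> x z2 y2 t2 w')"
    have A: "is_subring A" unfolding A_def by (rule is_subring_range[OF is_hom_ev5[OF \<iota>]])
    have mem: "\<iota> c \<in> A" "x \<in> A" "z2 \<in> A" "y2 \<in> A" "t2 \<in> A" "w' \<in> A" for c
      unfolding A_def by (rule range_eqI, rule ev5_simps[OF \<iota>, symmetric])+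
    note \<alpha>\<beta>A = closed[OF A mem(1,2,3,4)]
    have w: "w = \<alpha> * t2 - x * w'" using w' by simp
    have wA: "w \<in> A" unfolding w by (intro is_subring_intros A mem \<alpha>\<beta>A)
    have z1A: "z1 \<in> A" unfolding z1 by (intro is_subring_intros A mem wA)
    have z1': "z1 = z2 + x ^ (d + n) * (- w)" unfolding z1 by simp
    obtain q1 where q1: "q1 \<in> A" "y1 = y2 + x ^ n * (- w * ev2 \<iota> x z2 (pderiv P) + x * q1)"
      using translate_y[OF \<iota> A mem(1,2,3) is_subring_uminus[OF A wA] \<open>x \<noteq> 0\<close> \<open>d \<ge> 1\<close> y2 y1 z1']
      by blast
    have y1A: "y1 \<in> A" unfolding q1(2)
      by (intro is_subring_intros ev_in_subring is_hom_ev \<iota> A mem wA q1)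
    obtain q where q: "q \<in> A" "x * t1 = t2 - w * \<beta> + x * q" using \<beta>[OF A mem(1-4) wA] by blast
    obtain k where k: "k \<in> A" "\<alpha> * \<beta> = 1 + x * k" using \<alpha>[OF A mem(1-5)] by blast
    \<comment> \<open>Substituting for \<open>w\<close> leaves
      \<open>t2 * (1 - \<alpha> * \<beta>)\<close>, again a multiple of \<open>x\<close>.\<close>
    have "x * t1 = t2 - t2 * (\<alpha> * \<beta>) + x * w' * \<beta> + x * q"
      unfolding q(2) by (subst w) (simp add: algebra_simps)
    also have "\<dots> = x * (w' * \<beta> + q - t2 * k)" unfolding k(2) by (simp add: algebra_simps)
    finally have "t1 = w' * \<beta> + q - t2 * k" using \<open>x \<noteq> 0\<close> by simp
    then have t1A: "t1 \<in> A" by (simp only:) (intro is_subring_intros A mem \<alpha>\<beta>A q k)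
    show ?thesis
      unfolding A_def[symmetric] by (rule range_ev5_subset[OF \<iota> A mem(1,2) z1A y1A t1A wA])
  qed
qed

section \<open>Algebraic independence of the generators\<close>

lemma is_hom_ext_poly3:
  assumes f: "is_hom f" and g: "is_hom g"
    and "\<And>c. f [:[:[:c:]:]:] = g [:[:[:c:]:]:]" "f [:[:[:0, 1:]:]:] = g [:[:[:0, 1:]:]:]"
    "f [:[:0, 1:]:] = g [:[:0, 1:]:]" "f [:0, 1:] = g [:0, 1:]"
  shows "f p = g p"
proof -
  have 1: "f [:[:a:]:] = g [:[:a:]:]" for a
    by (rule is_hom_ext_poly[of "\<lambda>a. f [:[:a:]:]" "\<lambda>a. g [:[:a:]:]"])
      (intro is_hom_comp[OF f] is_hom_comp[OF g] is_hom_comp[OF is_hom_const_poly is_hom_const_poly] assms)+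
  have 2: "f [:a:] = g [:a:]" for a
    by (rule is_hom_ext_poly[of "\<lambda>a. f [:a:]" "\<lambda>a. g [:a:]"])
      (intro is_hom_comp[OF f] is_hom_comp[OF g] is_hom_const_poly assms 1)+
  show ?thesis by (rule is_hom_ext_poly[OF f g 2 assms(6)])
qed

lemma ev3_simps:
  assumes \<iota>: "is_hom \<iota>"
  shows "ev3 \<iota> x z w [:[:[:c:]:]:] = \<iota> c" "ev3 \<iota> x z w [:[:[:0, 1:]:]:] = x"
    "ev3 \<iota> x z w [:[:0, 1:]:] = z" "ev3 \<iota> x z w [:0, 1:] = w"
proof -
  note hom1 = is_hom_ev[OF \<iota>, of x]
  note hom2 = is_hom_ev[OF hom1, of z]
  note simps = ev_const[OF hom2] ev_const[OF hom1] ev_const[OF \<iota>] ev_var[OF hom2] ev_var[OF hom1] ev_var[OF \<iota>]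
  show "ev3 \<iota> x z w [:[:[:c:]:]:] = \<iota> c" "ev3 \<iota> x z w [:[:[:0, 1:]:]:] = x"
    "ev3 \<iota> x z w [:[:0, 1:]:] = z" "ev3 \<iota> x z w [:0, 1:] = w"
    by (simp_all only: simps)
qed

text \<open>The triangular substitution of Z - X^m W for Z is injective on k[X,Z,W], with the
  opposite shift as left inverse, so independence survives the change of \<open>z\<close>.\<close>

lemma ev3_shift_inj:
  fixes \<iota> :: "'k::comm_ring_1 \<Rightarrow> 'l::comm_ring_1"
  assumes \<iota>: "is_hom \<iota>" and inj: "\<And>p. ev3 \<iota> x z w p = 0 \<Longrightarrow> p = 0"
    and p: "ev3 \<iota> x (z - x ^ m * w) w p = 0"
  shows "p = 0"
proof -
  define C :: "'k \<Rightarrow> 'k poly poly poly" where "C c = [:[:[:c:]:]:]" for c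
  have C: "is_hom C"
    unfolding C_def by (rule is_hom_comp[OF is_hom_const_poly is_hom_comp[OF is_hom_const_poly is_hom_const_poly]])
  define x3 z3 w3 :: "'k poly poly poly" where "x3 = [:[:[:0, 1:]:]:]" and "z3 = [:[:0, 1:]:]" and "w3 = [:0, 1:]"
  define S where "S = ev3 C x3 (z3 - x3 ^ m * w3) w3"
  define S' where "S' = ev3 C x3 (z3 + x3 ^ m * w3) w3"
  have S: "is_hom S" and S': "is_hom S'" unfolding S_def S'_def by (intro is_hom_ev C)+
  note E = is_hom_ev[OF is_hom_ev[OF is_hom_ev[OF \<iota>]], of x z w]
  note S_simps = ev3_simps[OF C, of x3 "z3 - x3 ^ m * w3" w3, folded S_def, folded C_def x3_def z3_def w3_def]
  note S'_simps = ev3_simps[OF C, of x3 "z3 + x3 ^ m * w3" w3, folded S'_def, folded C_def x3_def z3_def w3_def]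
  note E_simps = ev3_simps[OF \<iota>, folded C_def x3_def z3_def w3_def]
  have "S' (S p) = p"
    by (rule is_hom_ext_poly3[OF is_hom_comp[OF S' S] is_homI, folded C_def x3_def z3_def w3_def])
      (simp_all add: S_simps S'_simps is_hom_simps[OF S'])
  have "ev3 \<iota> x z w (S p) = ev3 \<iota> x (z - x ^ m * w) w p"
    by (rule is_hom_ext_poly3[OF is_hom_comp[OF E S] is_hom_ev[OF is_hom_ev[OF is_hom_ev[OF \<iota>]]],
          folded C_def x3_def z3_def w3_def])
      (simp_all add: S_simps E_simps is_hom_simps[OF E])
  then have "S p = 0" using p inj by simp
  with \<open>S' (S p) = p\<close> show "p = 0" by (simp add: is_hom_zero[OF S'])
qed

text \<open>A nonconstant polynomial over a field is transcendental over that field, as composition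
  with it is injective.\<close>

lemma ev_const_fract_inj:
  fixes p :: "'a::idom poly"
  assumes "degree w > 0" and "ev (\<lambda>c. [:to_fract c:]) w p = 0"
  shows "p = 0"
proof -
  have "map_poly (\<lambda>c. [:to_fract c:]) p = map_poly (\<lambda>c. [:c:]) (map_poly to_fract p)"
    by (simp add: map_poly_map_poly o_def)
  then have "pcompose (map_poly to_fract p) w = 0"
    using assms(2) by (simp add: ev_def pcompose_altdef)
  then have "map_poly to_fract p = 0"
    using pcompose_eq_0 assms(1) by blast
  then show "p = 0"
    by (simp add: poly_eq_iff coeff_map_poly)
qed

theorem theorem3p14:
  fixes P :: "'k::field poly poly"
    and Q :: "'k poly poly poly"
    and r s d e :: nat
  assumes "lead_coeff P = 1" and "degree P = r" and "r \<ge> 2"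
    and "lead_coeff Q = 1" and "degree Q = s" and "s \<ge> 2"
    and "Idl\<^bsub>ring_of_type_algebra\<^esub> {P_at_X0 P, P_at_X0 (pderiv P)} = (UNIV :: 'k poly set)"
    and "Idl\<^bsub>ring_of_type_algebra\<^esub> {[:P_at_X0 P:], Q_at_X0 Q, Q_at_X0 (pderiv Q)}
           = (UNIV :: 'k poly poly set)"
    and "d \<ge> 1" and "e \<ge> 2"
  shows "algebra_isomorphic
           (UP (ring_B P Q d e)) (scalar_UP_B P Q d e)
           (UP (ring_B P Q d (e - 1))) (scalar_UP_B P Q d (e - 1))"
proof -
  obtain n where e: "e = Suc n" and n: "n \<ge> 1" using \<open>e \<ge> 2\<close> by (cases e) auto
  obtain u v where uv: "u * P_at_X0 P + v * P_at_X0 (pderiv P) = 1"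
  proof -
    have "1 \<in> {u * P_at_X0 P + v * P_at_X0 (pderiv P) | u v. True}"
      using assms(7) unfolding Idl_pair by simp
    then show ?thesis using that by auto
  qed
  obtain a b c where abc: "a * [:P_at_X0 P:] + b * Q_at_X0 Q + c * Q_at_X0 (pderiv Q) = 1"
  proof -
    have "1 \<in> Idl\<^bsub>ring_of_type_algebra\<^esub> {[:P_at_X0 P:], Q_at_X0 Q, Q_at_X0 (pderiv Q)}"
      unfolding assms(8) by simp
    then have "1 \<in> {a * [:P_at_X0 P:] + b * Q_at_X0 Q + c * Q_at_X0 (pderiv Q) | a b c. True}"
      using Idl_triple_subset by (rule rev_subsetD)
    then show ?thesis using that by auto
  qed
  \<comment> \<open>L is realised as polynomials in \<open>w\<close> over the fraction field of
    k[X,Z], and \<open>\<phi>\<close> embeds k[X,Z] as constants.\<close>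
  define \<phi> :: "'k poly poly \<Rightarrow> 'k poly poly fract poly" where "\<phi> c = [:to_fract c:]" for c
  have \<phi>: "is_hom \<phi>" by (rule is_homI) (simp_all add: \<phi>_def one_pCons[symmetric])
  define \<iota> where "\<iota> c = \<phi> [:[:c:]:]" for c
  define x where "x = \<phi> [:[:0, 1:]:]"
  define z2 where "z2 = \<phi> [:0, 1:]"
  define w :: "'k poly poly fract poly" where "w = [:0, 1:]"
  \<comment> \<open>L is not a field, so division by \<open>x\<close> is written as multiplication
    by its inverse \<open>x'\<close>.\<close>
  define x' where "x' = [:inverse (to_fract [:[:0, 1:]:]) :: 'k poly poly fract:]"
  have \<iota>: "is_hom \<iota>"
    unfolding \<iota>_def by (rule is_hom_comp[OF \<phi> is_hom_comp[OF is_hom_const_poly is_hom_const_poly]])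
  have xx': "x * x' = 1" by (simp add: x_def x'_def \<phi>_def one_pCons[symmetric])
  have x0: "x \<noteq> 0" using xx' by auto
  have cancel: "x ^ k * (f * x' ^ k) = f" for k f
  proof -
    have "x ^ k * (f * x' ^ k) = f * (x * x') ^ k" by (simp add: power_mult_distrib mult_ac)
    then show ?thesis by (simp add: xx')
  qed
  \<comment> \<open>Evaluation at \<open>x\<close> and \<open>z2\<close> is the embedding itself, so
    independence from \<open>w\<close> or \<open>w'\<close> reduces to transcendence over the
    fraction field.\<close>
  have \<phi>_eq: "ev2 \<iota> x z2 = \<phi>"
  proof
    fix f
    have 1: "ev \<iota> x g = \<phi> [:g:]" for g
      by (rule is_hom_ext_poly[OF is_hom_ev[OF \<iota>] is_hom_comp[OF \<phi> is_hom_const_poly]])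
        (simp_all add: ev_const[OF \<iota>] ev_var[OF \<iota>] \<iota>_def x_def)
    show "ev2 \<iota> x z2 f = \<phi> f"
      by (rule is_hom_ext_poly[OF is_hom_ev[OF is_hom_ev[OF \<iota>]] \<phi>])
        (simp_all add: ev_const[OF is_hom_ev[OF \<iota>]] ev_var[OF is_hom_ev[OF \<iota>]] 1 z2_def)
  qed
  define y2 where "y2 = ev2 \<iota> x z2 P * x' ^ d"
  define t2 where "t2 = ev3 \<iota> x z2 y2 Q * x' ^ n"
  define h where "h = ev2 \<iota> z2 y2 c * ev \<iota> z2 v * t2"
  define w' where "w' = (h - w) * x'"
  define z1 where "z1 = z2 - x ^ (d + n) * w"
  define y1 where "y1 = ev2 \<iota> x z1 P * x' ^ d"
  define t1 where "t1 = ev3 \<iota> x z1 y1 Q * x' ^ Suc n"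
  have eqs: "x ^ d * y1 = ev2 \<iota> x z1 P" "x ^ d * y2 = ev2 \<iota> x z2 P"
    "x ^ Suc n * t1 = ev3 \<iota> x z1 y1 Q" "x ^ n * t2 = ev3 \<iota> x z2 y2 Q"
    unfolding y1_def y2_def t1_def t2_def by (rule cancel)+
  have "x * w' = h - w" using cancel[of 1 "h - w"] by (simp add: w'_def)
  note range = range_ev5_eq[OF \<iota> x0 \<open>d \<ge> 1\<close> n eqs z1_def uv abc this[unfolded h_def]]
  \<comment> \<open>\<open>z2\<close>, \<open>y2\<close> and \<open>t2\<close> are constant in
    \<open>w\<close>, hence so is \<open>h\<close>, and \<open>w' = (h - w) / x\<close> has degree
    one.\<close>
  have "degree w' > 0"
  proof -
    define K :: "'k poly poly fract poly set" where "K = range (\<lambda>a. [:a:])"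
    have K: "is_subring K" unfolding K_def by (rule is_subring_range[OF is_hom_const_poly])
    have mem: "\<iota> c \<in> K" "x \<in> K" "z2 \<in> K" "x' \<in> K" for c
      by (auto simp: K_def \<iota>_def x_def z2_def x'_def \<phi>_def)
    have y2K: "y2 \<in> K" unfolding y2_def by (intro is_subring_intros ev_in_subring is_hom_ev \<iota> K mem)
    have t2K: "t2 \<in> K" unfolding t2_def by (intro is_subring_intros ev_in_subring is_hom_ev \<iota> K mem y2K)
    have "h \<in> K" unfolding h_def by (intro is_subring_intros ev_in_subring is_hom_ev \<iota> K mem y2K t2K)
    then obtain h0 where h0: "h = [:h0:]" unfolding K_def by blast
    show ?thesis unfolding w'_def x'_def h0 w_def by simp
  qed
  then have indep2: "p = 0" if "ev3 \<iota> x z2 w' p = 0" for p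
    using that unfolding \<phi>_eq unfolding \<phi>_def[abs_def] by (rule ev_const_fract_inj)
  have indep: "p = 0" if "ev3 \<iota> x z2 w p = 0" for p
    using that unfolding \<phi>_eq unfolding \<phi>_def[abs_def]
    by (rule ev_const_fract_inj[rotated]) (simp add: w_def)
  have indep1: "p = 0" if "ev3 \<iota> x z1 w p = 0" for p
    by (rule ev3_shift_inj[OF \<iota> _ that[unfolded z1_def]]) (rule indep)
  have ker1: "ev5 \<iota> x z1 y1 t1 w p = 0 \<longleftrightarrow> (\<forall>i. coeff p i \<in> ideal_B P Q d (Suc n))" for p
    by (rule ev_eq_0_iff_ideal_B[OF assms(1,4,9) _ \<iota> x0 eqs(1,3)]) (simp, rule indep1)
  have ker2: "ev5 \<iota> x z2 y2 t2 w' p = 0 \<longleftrightarrow> (\<forall>i. coeff p i \<in> ideal_B P Q d n)" for p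
    by (rule ev_eq_0_iff_ideal_B[OF assms(1,4,9) n \<iota> x0 eqs(2,4)]) (rule indep2)
  obtain f where f: "f \<in> ring_iso (UP (ring_B P Q d e)) (UP (ring_B P Q d (e - 1)))"
    and f_eq: "\<And>p q. ev5 \<iota> x z1 y1 t1 w p = ev5 \<iota> x z2 y2 t2 w' q \<Longrightarrow>
      f (coset_poly (ideal_B P Q d e) p) = coset_poly (ideal_B P Q d (e - 1)) q"
    using UP_Quot_iso[OF ideal_B_ideal ideal_B_ideal is_hom_ev5[OF \<iota>] is_hom_ev5[OF \<iota>] range ker1 ker2]
    unfolding ring_B_def e by auto
  \<comment> \<open>A scalar is the class of a constant polynomial, which both evaluations send to
    \<open>\<iota> c\<close>.\<close>
  have "f (scalar_UP_B P Q d e c) = scalar_UP_B P Q d (e - 1) c" for c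
    unfolding scalar_UP_B_def ring_B_def scalar_B_def coset_poly_const[OF ideal_B_ideal, symmetric]
    by (rule f_eq) (simp only: ev5_simps[OF \<iota>])
  with f show ?thesis unfolding algebra_isomorphic_def by blast
qed

end
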